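(* Let $Y\in\mathbb{K}^{n\times n}$ be a matrix such that $\sigma(Y)=Y^*$, and assume that $\sigma(D)$ is positive semi-definite for the matrix $D$ of singular values of $Y$. Then there exists a singular value decomposition $Y=UDV^*$ such that the matrix $\Theta=U^*\sigma(V)$ verifies $\sigma(\Theta)=\Theta^*$.
   Context: Let $\mathbb{K}$ be one of $\mathbb{R}$, $\mathbb{C}$, $\mathbb{H}$ (quaternions). For $A\in\mathbb{K}^{n\times n}$, $A^*$ is its conjugate transpose, and $O(n,\mathbb{K})=\{A\in\mathbb{K}^{n\times n}:AA^*=I\}$. $\sigma\colon\mathbb{K}^{n\times n}\to\mathbb{K}^{n\times n}$ is an involutive automorphism of unital (real) algebras satisfying $\sigma(Y^* )=\sigma(Y)^*$ for all $Y$. For $Y\in\mathbb{K}^{n\times n}$, the matrix $YY^*$ is Hermitian positive-semidefinite with eigenvalues $0,t_1^2,\dots,t_k^2$ of multiplicities $n_0,n_1,\dots,n_k$, $0<t_1<\dots<t_k$, $n_0+\cdots+n_k=n$; the matrix of singular values of $Y$ is the real diagonal matrix $D$ with diagonal blocks $0_{n_0},t_1I_{n_1},\dots,t_kI_{n_k}$. A singular value decomposition of $Y$ is a factorization $Y=UDV^*$ with $U,V\in O(n,\mathbb{K})$. *)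

theory Defs
  imports "HOL-Analysis.Analysis"
begin

section \<open>Quaternions\<close>

codatatype quat = Quat (qRe: real) (qI: real) (qJ: real) (qK: real)

lemma quat_eq_iff: "x = y \<longleftrightarrow> qRe x = qRe y \<and> qI x = qI y \<and> qJ x = qJ y \<and> qK x = qK y"
  by (auto intro: quat.expand)

instantiation quat :: ab_group_add
begin

primcorec zero_quat where
  "qRe 0 = 0" | "qI 0 = 0" | "qJ 0 = 0" | "qK 0 = 0"

primcorec plus_quat where
  "qRe (x + y) = qRe x + qRe y"
| "qI (x + y) = qI x + qI y"
| "qJ (x + y) = qJ x + qJ y"
| "qK (x + y) = qK x + qK y"

primcorec uminus_quat where
  "qRe (- x) = - qRe x"
| "qI (- x) = - qI x"
| "qJ (- x) = - qJ x"
| "qK (- x) = - qK x"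

primcorec minus_quat where
  "qRe (x - y) = qRe x - qRe y"
| "qI (x - y) = qI x - qI y"
| "qJ (x - y) = qJ x - qJ y"
| "qK (x - y) = qK x - qK y"

instance
  by standard (simp_all add: quat_eq_iff)

end

instantiation quat :: real_algebra_1
begin

primcorec one_quat where
  "qRe 1 = 1" | "qI 1 = 0" | "qJ 1 = 0" | "qK 1 = 0"

primcorec times_quat where
  "qRe (x * y) = qRe x * qRe y - qI x * qI y - qJ x * qJ y - qK x * qK y"
| "qI (x * y) = qRe x * qI y + qI x * qRe y + qJ x * qK y - qK x * qJ y"
| "qJ (x * y) = qRe x * qJ y - qI x * qK y + qJ x * qRe y + qK x * qI y"
| "qK (x * y) = qRe x * qK y + qI x * qJ y - qJ x * qI y + qK x * qRe y"

primcorec scaleR_quat where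
  "qRe (scaleR r x) = r * qRe x"
| "qI (scaleR r x) = r * qI x"
| "qJ (scaleR r x) = r * qJ x"
| "qK (scaleR r x) = r * qK x"

instance
  by standard (simp_all add: quat_eq_iff algebra_simps)

end

lemma quat_units:
  defines "i \<equiv> Quat 0 1 0 0" and "j \<equiv> Quat 0 0 1 0" and "k \<equiv> Quat 0 0 0 1"
  shows "i * i = - 1" "j * j = - 1" "k * k = - 1" "i * j * k = - 1"
  by (simp_all add: assms quat_eq_iff)

section \<open>Scalars with conjugation\<close>

class conj_algebra = real_algebra_1 +
  fixes conjugate :: "'a \<Rightarrow> 'a"
  assumes conjugate_add: "conjugate (x + y) = conjugate x + conjugate y"
    and conjugate_scaleR: "conjugate (scaleR r x) = scaleR r (conjugate x)"
    and conjugate_mult: "conjugate (x * y) = conjugate y * conjugate x"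
    and conjugate_conjugate: "conjugate (conjugate x) = x"

instantiation real :: conj_algebra
begin

definition conjugate_real :: "real \<Rightarrow> real" where
  "conjugate_real x = x"

instance
  by standard (simp_all add: conjugate_real_def)

end

instantiation complex :: conj_algebra
begin

definition conjugate_complex :: "complex \<Rightarrow> complex" where
  "conjugate_complex = cnj"

instance
  by standard (simp_all add: conjugate_complex_def)

end

instantiation quat :: conj_algebra
begin

primcorec conjugate_quat where
  "qRe (conjugate x) = qRe x"
| "qI (conjugate x) = - qI x"
| "qJ (conjugate x) = - qJ x"
| "qK (conjugate x) = - qK x"

instance
  by standard (simp_all add: quat_eq_iff algebra_simps)

end

section \<open>Matrices\<close>

definition conj_transpose :: "'k::conj_algebra^'n^'m \<Rightarrow> 'k^'m^'n" where
  "conj_transpose A = (\<chi> i j. conjugate (A $ j $ i))"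

definition unitary_group :: "('k::conj_algebra^'n^'n) set" where
  "unitary_group = {A. A ** conj_transpose A = mat 1}"

text \<open>
  The condition on the Hermitian form says that its value at \<open>x\<close> is a
  non-negative real scalar.
\<close>

definition pos_semidef :: "'k::conj_algebra^'n^'n \<Rightarrow> bool" where
  "pos_semidef A \<longleftrightarrow> conj_transpose A = A \<and>
     (\<forall>x. \<exists>r::real. 0 \<le> r \<and> (\<Sum>i\<in>UNIV. conjugate (x $ i) * (A *v x) $ i) = of_real r)"

text \<open>
  Column vectors form a right module over the scalars, so that left
  multiplication by a matrix is linear also over the quaternions; the library's
  \<open>independent\<close>, \<open>span\<close> and \<open>dim\<close> would
  refer to real scalars.
\<close>

definition right_scale :: "'k::real_algebra_1^'n \<Rightarrow> 'k \<Rightarrow> 'k^'n" where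
  "right_scale x c = (\<chi> i. x $ i * c)"

definition right_basis :: "('k::real_algebra_1^'n) set \<Rightarrow> ('k^'n) set \<Rightarrow> bool" where
  "right_basis B S \<longleftrightarrow> finite B \<and>
     (\<forall>c. (\<Sum>b\<in>B. right_scale b (c b)) = 0 \<longrightarrow> (\<forall>b\<in>B. c b = 0)) \<and>
     S = range (\<lambda>c. \<Sum>b\<in>B. right_scale b (c b))"

definition right_dim :: "('k::real_algebra_1^'n) set \<Rightarrow> nat" where
  "right_dim S = card (SOME B. right_basis B S)"

text \<open>
  Only real \<open>\<mu>\<close> are needed, since the eigenvalues of a Hermitian matrix are
  real. The multiplicity is 0 if \<open>\<mu>\<close> is not an eigenvalue.
\<close>

definition eigen_multiplicity :: "'k::real_algebra_1^'n^'n \<Rightarrow> real \<Rightarrow> nat" where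
  "eigen_multiplicity A \<mu> = right_dim {x. A *v x = \<mu> *\<^sub>R x}"

text \<open>
  The diagonal entries are listed in increasing order, which gives the blocks
  $0_{n_0}, t_1 I_{n_1}, \dots, t_k I_{n_k}$ with $0 < t_1 < \dots < t_k$.
\<close>

definition singular_value_matrix ::
  "'k::conj_algebra^'n::{finite,linorder}^'n::_ \<Rightarrow> 'k^'n::_^'n::_ \<Rightarrow> bool" where
  "singular_value_matrix Y D \<longleftrightarrow>
     (\<exists>s :: 'n \<Rightarrow> real. mono s \<and> (\<forall>i. 0 \<le> s i) \<and>
        D = (\<chi> i j. if i = j then of_real (s i) else 0) \<and>
        (\<forall>t\<ge>0. card {i. s i = t} = eigen_multiplicity (Y ** conj_transpose Y) (t\<^sup>2)))"

definition is_svd ::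
  "'k::conj_algebra^'n::{finite,linorder}^'n::_ \<Rightarrow> 'k^'n::_^'n::_ \<Rightarrow> 'k^'n::_^'n::_ \<Rightarrow> 'k^'n::_^'n::_ \<Rightarrow> bool" where
  "is_svd Y U D V \<longleftrightarrow> singular_value_matrix Y D \<and>
     U \<in> unitary_group \<and> V \<in> unitary_group \<and> Y = U ** D ** conj_transpose V"

definition involutive_automorphism :: "('k::real_algebra_1^'n^'n \<Rightarrow> 'k^'n^'n) \<Rightarrow> bool" where
  "involutive_automorphism \<sigma> \<longleftrightarrow> linear \<sigma> \<and> (\<forall>A B. \<sigma> (A ** B) = \<sigma> A ** \<sigma> B) \<and>
     \<sigma> (mat 1) = mat 1 \<and> (\<forall>A. \<sigma> (\<sigma> A) = A)"

end

(* A unit vector in the range of the projection \<sigma>(E_11), moved by the partial isometries \<sigma>(E_i1), gives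
   a unitary S with \<sigma>(X) = S \<phi>(X) S* for an automorphism \<phi> of the scalars acting entrywise, and S can
   be chosen such that \<phi> is the identity or complex conjugation and S \<phi>(S) = \<epsilon> with \<epsilon> = 1 or \<epsilon> = -1.
   The spectral theorem gives Y Y* = U D^2 U*. Then H = U* Y \<sigma>(U) S satisfies \<phi>(H) = \<epsilon> H* and
   H H* = H* H = D^2, so H commutes with D^2 and H = D G with G unitary, determined by H on the nonzero
   singular values and free on the kernel of D. If G \<phi>(G) = \<epsilon> also on the kernel, then \<Theta> = G S* and
   V = \<sigma>(U) \<Theta>* are as desired. For \<epsilon> = -1 over the reals or complex numbers such a G exists on the
   kernel only in even dimension; determinants of S and of G completed by the identity show that both n
   and the rank of D are even. Over the quaternions the scalar i does. *)

theory Submission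
  imports Defs "HOL-Combinatorics.Permutations"
begin

section \<open>Conjugation algebras with a multiplicative Euclidean norm\<close>

text \<open>Writing \<Theta> as G times the adjoint of S turns the condition on \<Theta> into
  \<phi>(G) = \<epsilon> G*, in which \<sigma> occurs only through the entrywise map. The matrix U*
  Y \<sigma>(U) is sent to its adjoint by \<sigma>, and right multiplication by S translates this
  into the same equation for H. Dividing by the nonzero singular values preserves the equation
  because H links only equal ones. The difficulty is thus concentrated on the kernel of D, where
  nothing prescribes G. The sign \<epsilon> stems from \<sigma> being an involution: once \<phi> is
  one too, S \<phi>(S) commutes with all matrices, and only a central scalar of modulus one fixed by
  \<phi> remains. Over the complex numbers with trivial \<phi> it can be scaled away; with
  conjugation a phase factor in S leaves it unchanged, so both signs have to be treated. As
  quaternions do not commute, orthogonality, dimension and eigenvectors are handled through the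
  underlying real inner product, which serves the three kinds of scalars at once; determinants enter
  only for commutative scalars.\<close>

class conj_division_algebra = conj_algebra + euclidean_space +
  assumes conjugate_mult_self_scaleR: "conjugate x * x = (x \<bullet> x) *\<^sub>R 1"

lemma conjugate_mult_self: "conjugate x * x = of_real (x \<bullet> x)"
  for x :: "'k::conj_division_algebra"
  by (simp add: conjugate_mult_self_scaleR of_real_def)

instance real :: conj_division_algebra
  by standard (simp add: conjugate_real_def)

instance complex :: conj_division_algebra
  by standard (simp add: conjugate_complex_def complex_eq_iff inner_complex_def)

instantiation quat :: real_inner
begin

definition inner_quat :: "quat \<Rightarrow> quat \<Rightarrow> real" where
  "inner_quat x y = qRe x * qRe y + qI x * qI y + qJ x * qJ y + qK x * qK y"

definition norm_quat :: "quat \<Rightarrow> real" where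
  "norm_quat x = sqrt (inner x x)"

definition dist_quat :: "quat \<Rightarrow> quat \<Rightarrow> real" where
  "dist_quat x y = norm (x - y)"

definition sgn_quat :: "quat \<Rightarrow> quat" where
  "sgn_quat x = x /\<^sub>R norm x"

definition uniformity_quat :: "(quat \<times> quat) filter" where
  "uniformity_quat = (INF e\<in>{0<..}. principal {(x, y). dist x y < e})"

definition open_quat :: "quat set \<Rightarrow> bool" where
  "open_quat U \<longleftrightarrow> (\<forall>x\<in>U. eventually (\<lambda>(x', y). x' = x \<longrightarrow> y \<in> U) uniformity)"

instance
proof
  fix x y z :: quat and r :: real and U :: "quat set"
  show "dist x y = norm (x - y)" by (rule dist_quat_def)
  show "sgn x = x /\<^sub>R norm x" by (rule sgn_quat_def)
  show "uniformity = (INF e\<in>{0<..}. principal {(x, y). dist (x::quat) y < e})"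
    by (rule uniformity_quat_def)
  show "open U \<longleftrightarrow> (\<forall>x\<in>U. eventually (\<lambda>(x', y). x' = x \<longrightarrow> y \<in> U) uniformity)"
    by (rule open_quat_def)
  show "inner x y = inner y x" by (simp add: inner_quat_def mult.commute)
  show "inner (x + y) z = inner x z + inner y z" by (simp add: inner_quat_def algebra_simps)
  show "inner (scaleR r x) y = r * inner x y" by (simp add: inner_quat_def algebra_simps)
  show "0 \<le> inner x x" by (simp add: inner_quat_def)
  show "inner x x = 0 \<longleftrightarrow> x = 0"
    by (simp add: inner_quat_def quat_eq_iff add_nonneg_eq_0_iff)
  show "norm x = sqrt (inner x x)" by (rule norm_quat_def)
qed

end

instantiation quat :: euclidean_space
begin

definition Basis_quat :: "quat set" where
  "Basis_quat = {Quat 1 0 0 0, Quat 0 1 0 0, Quat 0 0 1 0, Quat 0 0 0 1}"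

instance
proof
  show "(Basis :: quat set) \<noteq> {}" "finite (Basis :: quat set)"
    by (simp_all add: Basis_quat_def)
next
  fix u v :: quat
  assume "u \<in> Basis" "v \<in> Basis"
  then show "inner u v = (if u = v then 1 else 0)"
    unfolding Basis_quat_def by (elim insertE emptyE) (simp_all add: inner_quat_def)
next
  fix x :: quat
  show "(\<forall>u\<in>Basis. inner x u = 0) \<longleftrightarrow> x = 0"
    by (simp add: Basis_quat_def inner_quat_def quat_eq_iff[of x])
qed

end

lemma qsel_of_real [simp]:
  "qRe (of_real r) = r" "qI (of_real r) = 0" "qJ (of_real r) = 0" "qK (of_real r) = 0"
  by (simp_all add: of_real_def)

instance quat :: conj_division_algebra
  by standard (simp add: quat_eq_iff inner_quat_def algebra_simps)

context conj_algebra
begin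

lemma conjugate_zero [simp]: "conjugate 0 = 0"
  using conjugate_add[of 0 0] by simp

lemma conjugate_one [simp]: "conjugate 1 = 1"
  using conjugate_mult[of "conjugate 1" 1] by (simp add: conjugate_conjugate)

end

declare conjugate_conjugate [simp]

lemma conjugate_of_real [simp]: "conjugate (of_real r :: 'k::conj_algebra) = of_real r"
  by (simp add: of_real_def conjugate_scaleR)

lemma conjugate_sum: "conjugate (sum f A) = (\<Sum>i\<in>A. conjugate (f i :: 'k::conj_algebra))"
  by (induction A rule: infinite_finite_induct) (simp_all add: conjugate_add)

lemma conjugate_mult_polarized:
  fixes x y :: "'k::conj_division_algebra"
  shows "conjugate x * y + conjugate y * x = of_real (2 * (x \<bullet> y))"
proof -
  have "conjugate (x + y) * (x + y) = of_real ((x + y) \<bullet> (x + y))"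
    by (rule conjugate_mult_self)
  then have "conjugate x * x + conjugate x * y + (conjugate y * x + conjugate y * y) =
      of_real (x \<bullet> x) + of_real (2 * (x \<bullet> y)) + of_real (y \<bullet> y)"
    by (simp add: conjugate_add inner_add_left inner_add_right distrib_left distrib_right
        inner_commute algebra_simps)
  then show ?thesis
    by (simp add: conjugate_mult_self algebra_simps)
qed

lemma of_real_scaleR_mult: "of_real r * x = r *\<^sub>R (x :: 'k::real_algebra_1)"
  by (simp add: of_real_def)

lemma mult_of_real_scaleR: "x * of_real r = r *\<^sub>R (x :: 'k::real_algebra_1)"
  by (simp add: of_real_def)

section \<open>The Hermitian product and matrices\<close>

definition herm :: "'k::conj_algebra^'n \<Rightarrow> 'k^'n \<Rightarrow> 'k" where
  "herm x y = (\<Sum>i\<in>UNIV. conjugate (x $ i) * y $ i)"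

lemma herm_add_right: "herm x (y + z) = herm x y + herm x z"
  by (simp add: herm_def distrib_left sum.distrib)

lemma herm_scaleR_right: "herm x (r *\<^sub>R y) = r *\<^sub>R herm x y"
  by (simp add: herm_def scaleR_right.sum)

lemma herm_zero_right [simp]: "herm x 0 = 0"
  by (simp add: herm_def)

lemma herm_right_scale_right: "herm x (right_scale y c) = herm x y * c"
  by (simp add: herm_def right_scale_def sum_distrib_right mult.assoc)

lemma conjugate_herm: "conjugate (herm x y) = herm y x"
  by (simp add: herm_def conjugate_sum conjugate_mult)

lemma herm_right_scale_left: "herm (right_scale x c) y = conjugate c * herm x y"
  by (subst (1 2) conjugate_herm [symmetric]) (simp only: conjugate_mult herm_right_scale_right)

lemma herm_scaleR_left: "herm (r *\<^sub>R x) y = r *\<^sub>R herm x y"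
  by (subst (1 2) conjugate_herm [symmetric]) (simp only: conjugate_scaleR herm_scaleR_right)

lemma herm_self: "herm x x = of_real (x \<bullet> x)"
  for x :: "'k::conj_division_algebra^'n"
  by (simp add: herm_def inner_vec_def conjugate_mult_self)

lemma herm_polarized: "herm x y + herm y x = of_real (2 * (x \<bullet> y))"
  for x y :: "'k::conj_division_algebra^'n"
proof -
  have "herm x y + herm y x = (\<Sum>i\<in>UNIV. of_real (2 * (x $ i \<bullet> y $ i)))"
    by (simp add: herm_def conjugate_mult_polarized flip: sum.distrib)
  then show ?thesis
    by (simp add: inner_vec_def sum_distrib_left)
qed

lemma herm_matrix_right: "herm x (A *v y) = herm (conj_transpose A *v x) y"
proof -
  have "herm x (A *v y) = (\<Sum>i\<in>UNIV. \<Sum>j\<in>UNIV. conjugate (x $ i) * A $ i $ j * y $ j)"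
    by (simp add: herm_def matrix_vector_mult_def sum_distrib_left mult.assoc)
  also have "\<dots> = (\<Sum>j\<in>UNIV. \<Sum>i\<in>UNIV. conjugate (x $ i) * A $ i $ j * y $ j)"
    by (rule sum.swap)
  also have "\<dots> = herm (conj_transpose A *v x) y"
    by (simp add: herm_def matrix_vector_mult_def conj_transpose_def conjugate_sum
        conjugate_mult sum_distrib_right)
  finally show ?thesis .
qed

text \<open>Taking \<open>c\<close> to be \<open>herm x y\<close> itself turns the real inner
  product into the squared norm of \<open>herm x y\<close>. Hence real orthogonality to the whole
  right line through \<open>x\<close> is as strong as Hermitian orthogonality.\<close>

lemma herm_eq_0_if_inner_eq_0:
  fixes x y :: "'k::conj_division_algebra^'n"
  assumes "\<And>c. right_scale x c \<bullet> y = 0"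
  shows "herm x y = 0"
proof -
  define c where "c = herm x y"
  have "herm (right_scale x c) y + herm y (right_scale x c) = 0"
    using assms by (simp add: herm_polarized)
  moreover have "herm (right_scale x c) y = conjugate c * c"
    by (simp add: herm_right_scale_left c_def)
  moreover have "herm y (right_scale x c) = conjugate c * c"
    by (simp add: herm_right_scale_right c_def conjugate_herm)
  ultimately have "of_real (c \<bullet> c) + of_real (c \<bullet> c) = (0::'k)"
    by (simp add: conjugate_mult_self)
  then have "c \<bullet> c + c \<bullet> c = 0"
    by (metis of_real_add of_real_eq_0_iff)
  then show ?thesis by (simp add: c_def)
qed

lemma conj_transpose_conj_transpose [simp]: "conj_transpose (conj_transpose A) = A"
  by (simp add: conj_transpose_def vec_eq_iff)

lemma inner_adjoint:
  fixes x y :: "'k::conj_division_algebra^'n"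
  shows "x \<bullet> (A *v y) = (conj_transpose A *v x) \<bullet> y"
proof -
  have "of_real (2 * (x \<bullet> (A *v y))) = (of_real (2 * ((conj_transpose A *v x) \<bullet> y)) :: 'k)"
    by (simp only: herm_matrix_right conj_transpose_conj_transpose flip: herm_polarized)
  then show ?thesis by (simp only: of_real_eq_iff)
qed

section \<open>Matrix algebra: adjoints, unitary matrices, diagonal matrices\<close>

lemma conj_transpose_mult: "conj_transpose (A ** B) = conj_transpose B ** conj_transpose A"
  by (simp add: conj_transpose_def matrix_matrix_mult_def vec_eq_iff conjugate_sum conjugate_mult)

lemma conj_transpose_mult_nth: "(conj_transpose A ** B) $ i $ j = herm (column i A) (column j B)"
  by (simp add: conj_transpose_def matrix_matrix_mult_def herm_def column_def)

lemma column_matrix_mult: "column j (A ** B) = A *v column j B"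
  by (simp add: column_def matrix_matrix_mult_def matrix_vector_mult_def)

lemma linear_matrix_vector_mult: "linear ((*v) A)"
  for A :: "'k::real_algebra_1^'n^'m"
  by (rule linearI)
     (simp_all add: matrix_vector_mult_def vec_eq_iff distrib_left sum.distrib scaleR_right.sum)

lemma linear_matrix_mult_left: "linear ((**) A)"
  for A :: "'k::real_algebra_1^'n^'m"
  by (rule linearI)
     (simp_all add: matrix_matrix_mult_def vec_eq_iff distrib_left sum.distrib scaleR_right.sum)

lemma linear_matrix_mult_right: "linear (\<lambda>A. A ** B)"
  for B :: "'k::real_algebra_1^'n^'m"
  by (rule linearI)
     (simp_all add: matrix_matrix_mult_def vec_eq_iff distrib_right sum.distrib scaleR_right.sum)

lemma matrix_eq_iff_vec: "A = B \<longleftrightarrow> (\<forall>x. A *v x = B *v x)"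
  for A B :: "'k::semiring_1^'n^'m"
proof safe
  assume *: "\<forall>x. A *v x = B *v x"
  have "A *v axis j 1 = column j A" "B *v axis j 1 = column j B" for j
    by (simp_all add: matrix_vector_mult_def column_def axis_def vec_eq_iff if_distrib cong: if_cong)
  with * show "A = B"
    by (simp add: column_def vec_eq_iff)
qed

text \<open>The usual determinant argument fails for noncommutative scalars. Instead
  \<open>B\<close> is viewed as a real-linear endomorphism of a finite-dimensional real space, where
  injectivity implies surjectivity.\<close>

lemma matrix_left_inverse_imp_right:
  fixes A B :: "'k::conj_division_algebra^'n^'n"
  assumes "A ** B = mat 1"
  shows "B ** A = mat 1"
proof -
  have AB: "A *v (B *v x) = x" for x
    using assms by (simp add: matrix_vector_mul_assoc)
  then have "inj ((*v) B)"
    by (metis injI)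
  then have "surj ((*v) B)"
    by (rule linear_injective_imp_surjective[OF linear_matrix_vector_mult _ refl])
  then have "B *v (A *v x) = x" for x
    using AB by (metis surjD)
  then show ?thesis
    by (simp add: matrix_eq_iff_vec flip: matrix_vector_mul_assoc)
qed

lemma unitary_group_iff:
  fixes U :: "'k::conj_division_algebra^'n^'n"
  shows "U \<in> unitary_group \<longleftrightarrow> conj_transpose U ** U = mat 1"
  by (auto simp: unitary_group_def intro: matrix_left_inverse_imp_right)

lemma unitary_group_mult:
  fixes U V :: "'k::conj_algebra^'n^'n"
  assumes "U \<in> unitary_group" "V \<in> unitary_group"
  shows "U ** V \<in> unitary_group"
proof -
  have "(U ** V) ** conj_transpose (U ** V) = U ** (V ** conj_transpose V) ** conj_transpose U"
    by (simp only: conj_transpose_mult matrix_mul_assoc)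
  with assms show ?thesis
    by (simp add: unitary_group_def)
qed

lemma unitary_group_conj_transpose:
  fixes U :: "'k::conj_division_algebra^'n^'n"
  shows "U \<in> unitary_group \<Longrightarrow> conj_transpose U \<in> unitary_group"
  using unitary_group_iff[of U] by (simp add: unitary_group_def)

lemma scaleR_matrix_mult: "(r *\<^sub>R A) ** B = r *\<^sub>R (A ** B)"
  for A :: "'k::real_algebra_1^'n^'m"
  by (rule linear_scale[OF linear_matrix_mult_right])

lemma matrix_mult_scaleR: "A ** (r *\<^sub>R B) = r *\<^sub>R (A ** B)"
  for A :: "'k::real_algebra_1^'n^'m"
  by (rule linear_scale[OF linear_matrix_mult_left])

lemma matrix_add_rdistrib: "(A + B) ** C = A ** C + B ** C"
  for A :: "'k::real_algebra_1^'n^'m"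
  by (rule linear_add[OF linear_matrix_mult_right])

lemma conj_transpose_scaleR: "conj_transpose (r *\<^sub>R A) = r *\<^sub>R conj_transpose A"
  by (simp add: conj_transpose_def vec_eq_iff conjugate_scaleR)

lemma conj_transpose_add: "conj_transpose (A + B) = conj_transpose A + conj_transpose B"
  by (simp add: conj_transpose_def vec_eq_iff conjugate_add)

lemma conj_transpose_zero [simp]: "conj_transpose 0 = 0"
  by (simp add: conj_transpose_def vec_eq_iff)

definition diagonal :: "('n \<Rightarrow> real) \<Rightarrow> 'k::real_algebra_1^'n^'n" where
  "diagonal s = (\<chi> i j. if i = j then of_real (s i) else 0)"

lemma diagonal_mult_nth: "(diagonal s ** A) $ i $ j = s i *\<^sub>R A $ i $ j"
  by (simp add: diagonal_def matrix_matrix_mult_def of_real_scaleR_mult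
      if_distrib[of "\<lambda>x. x * _"] cong: if_cong)

lemma mult_diagonal_nth: "(A ** diagonal s) $ i $ j = s j *\<^sub>R A $ i $ j"
  by (simp add: diagonal_def matrix_matrix_mult_def mult_of_real_scaleR
      if_distrib[of "\<lambda>x. _ * x"] cong: if_cong)

lemma diagonal_mult_vec_nth: "(diagonal s *v x) $ i = s i *\<^sub>R x $ i"
  by (simp add: diagonal_def matrix_vector_mult_def of_real_scaleR_mult
      if_distrib[of "\<lambda>x. x * _"] cong: if_cong)

lemma conj_transpose_diagonal [simp]: "conj_transpose (diagonal s) = diagonal s"
  by (simp add: conj_transpose_def diagonal_def vec_eq_iff)

lemma diagonal_nth: "diagonal s $ i $ j = (if i = j then of_real (s i) else 0)"
  by (simp add: diagonal_def)

lemma diagonal_mult_diagonal: "diagonal s ** diagonal t = diagonal (\<lambda>i. s i * t i)"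
  unfolding vec_eq_iff diagonal_mult_nth by (simp add: diagonal_def of_real_def)

lemma mat_of_real: "mat (of_real r) = r *\<^sub>R (mat 1 :: 'k::real_algebra_1^'n^'n)"
  by (simp add: mat_def vec_eq_iff of_real_def)

section \<open>The spectral theorem\<close>

lemma linear_right_scale: "linear (right_scale x)"
  by (rule linearI) (simp_all add: right_scale_def vec_eq_iff distrib_left)

text \<open>Gives a right line finitely many real generators, so that real dimension counts apply to
  right spans.\<close>

lemma right_scale_in_span_Basis:
  fixes x :: "'k::conj_division_algebra^'n"
  shows "right_scale x c \<in> span (right_scale x ` Basis)"
proof -
  have "right_scale x c \<in> right_scale x ` span Basis"
    by simp
  then show ?thesis
    by (simp only: linear_span_image[OF linear_right_scale])
qed

text \<open>The right span of the vectors \<open>v i\<close> has real dimension at most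
  \<open>card I * DIM('k)\<close>, which is less than that of the whole space. A real orthogonal
  vector therefore exists, and it is Hermitian orthogonal because the span contains whole right
  lines.\<close>

lemma exists_herm_orthogonal:
  fixes v :: "'n::finite \<Rightarrow> 'k::conj_division_algebra^'n"
  assumes "I \<noteq> UNIV"
  shows "\<exists>x. x \<noteq> 0 \<and> (\<forall>i\<in>I. herm (v i) x = 0)"
proof -
  define T where "T = (\<lambda>(i, e). right_scale (v i) e) ` (I \<times> (Basis::'k set))"
  have "card I < CARD('n)"
    using assms by (simp add: psubset_card_mono psubset_eq)
  then have "card I * DIM('k) < DIM('k^'n)"
    by simp
  moreover have "dim T \<le> card I * DIM('k)"
    using dim_le_card[of T T] card_image_le[of "I \<times> (Basis::'k set)" "\<lambda>(i, e). right_scale (v i) e"]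
    by (simp add: T_def span_superset card_cartesian_product)
  ultimately obtain x where x: "x \<noteq> 0" "\<And>y. y \<in> span T \<Longrightarrow> orthogonal x y"
    using orthogonal_to_subspace_exists[of T] by (metis le_less_trans)
  have "herm (v i) x = 0" if "i \<in> I" for i
  proof (rule herm_eq_0_if_inner_eq_0)
    fix c
    have "right_scale (v i) ` Basis \<subseteq> T"
      using that by (auto simp: T_def)
    then have "right_scale (v i) c \<in> span T"
      using right_scale_in_span_Basis span_mono by blast
    then show "right_scale (v i) c \<bullet> x = 0"
      using x(2) unfolding orthogonal_def by (metis inner_commute)
  qed
  with x(1) show ?thesis by blast
qed

text \<open>A maximizer of the Rayleigh quotient on the unit sphere of \<open>W\<close> is an eigenvector.\<close>

lemma hermitian_eigenvector_in_subspace: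
  fixes A :: "'k::conj_division_algebra^'n^'n"
  assumes herm: "conj_transpose A = A" and W: "subspace W" and inv: "\<And>x. x \<in> W \<Longrightarrow> A *v x \<in> W"
    and "w \<in> W" "w \<noteq> 0"
  obtains v \<mu> where "v \<in> W" "norm v = 1" "A *v v = \<mu> *\<^sub>R v"
proof -
  note lin = linear_matrix_vector_mult[of A]
  have cont: "continuous_on (W \<inter> sphere 0 1) (\<lambda>x. x \<bullet> (A *v x))"
    by (intro continuous_intros linear_continuous_on linear_conv_bounded_linear[THEN iffD1] lin)
  have "compact (W \<inter> sphere 0 1)"
    by (intro closed_Int_compact closed_subspace W compact_sphere)
  moreover have "inverse (norm w) *\<^sub>R w \<in> W \<inter> sphere 0 1"
    using assms by (auto simp: subspace_scale)
  ultimately obtain v where v: "v \<in> W" "norm v = 1"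
    and max: "\<And>y. y \<in> W \<Longrightarrow> norm y = 1 \<Longrightarrow> y \<bullet> (A *v y) \<le> v \<bullet> (A *v v)"
    using continuous_attains_sup[OF _ _ cont] by fastforce
  define \<mu> where "\<mu> = v \<bullet> (A *v v)"
  \<comment> \<open>By maximality the form of \<open>B\<close> is nonnegative on \<open>W\<close>,
    and it vanishes at \<open>v\<close>. Minimality of the form at \<open>v\<close> will force
    \<open>B v = 0\<close>.\<close>
  define B where "B x = \<mu> *\<^sub>R x - A *v x" for x
  have BW: "B x \<in> W" if "x \<in> W" for x
    unfolding B_def by (intro subspace_diff subspace_scale W inv that)
  have B_add: "B (x + y) = B x + B y" and B_scale: "B (r *\<^sub>R x) = r *\<^sub>R B x" for x y r
    by (simp_all add: B_def linear_add[OF lin] linear_scale[OF lin] algebra_simps)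
  have B_sym: "x \<bullet> B y = y \<bullet> B x" for x y
    using inner_adjoint[of x A y] herm by (simp add: B_def inner_diff_right inner_commute)
  have B_nonneg: "0 \<le> x \<bullet> B x" if "x \<in> W" for x
  proof (cases "x = 0")
    case False
    define y where "y = inverse (norm x) *\<^sub>R x"
    have "y \<in> W" "norm y = 1" and x: "x = norm x *\<^sub>R y"
      using False that W by (auto simp: y_def subspace_scale)
    then have "0 \<le> y \<bullet> B y"
      using max[of y] by (simp add: B_def inner_diff_right dot_square_norm \<mu>_def)
    then have "0 \<le> (norm x)\<^sup>2 * (y \<bullet> B y)"
      by simp
    also have "\<dots> = x \<bullet> B x"
      using arg_cong[OF x, of "\<lambda>z. z \<bullet> B z"] by (simp add: B_scale power2_eq_square)
    finally show ?thesis .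
  qed simp
  have "v \<bullet> B v = 0"
    using v by (simp add: B_def \<mu>_def inner_diff_right dot_square_norm)
  define h where "h = B v"
  have "h \<in> W"
    using BW v h_def by blast
  \<comment> \<open>This is the form at \<open>v + t h\<close>. Symmetry of \<open>B\<close> makes
    the linear coefficient twice
    \<open>v \<bullet> B h = h \<bullet> B v = h \<bullet> h\<close>.\<close>
  have quad: "0 \<le> 2 * t * (h \<bullet> h) + t\<^sup>2 * (h \<bullet> B h)" for t
  proof -
    have "0 \<le> (v + t *\<^sub>R h) \<bullet> B (v + t *\<^sub>R h)"
      by (intro B_nonneg subspace_add subspace_scale W v \<open>h \<in> W\<close>)
    also have "\<dots> = 2 * t * (h \<bullet> h) + t\<^sup>2 * (h \<bullet> B h)"
      using \<open>v \<bullet> B v = 0\<close> B_sym[of v h]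
      by (simp add: B_add B_scale inner_add_left inner_add_right h_def[symmetric] power2_eq_square
          algebra_simps)
    finally show ?thesis .
  qed
  have "h \<bullet> h = 0"
  proof (rule ccontr)
    assume "h \<bullet> h \<noteq> 0"
    then have pos: "0 < h \<bullet> h" by simp
    \<comment> \<open>The summand 1 keeps the divisor in \<open>t\<close> positive even when
      \<open>h \<bullet> B h\<close> is 0. For this negative \<open>t\<close> the factor
      \<open>2 * (h \<bullet> h) + t * (h \<bullet> B h)\<close> is at least
      \<open>h \<bullet> h\<close>, whereas \<open>quad\<close> makes it nonpositive.\<close>
    define b where "b = h \<bullet> B h + 1"
    have b: "0 < b" using B_nonneg[OF \<open>h \<in> W\<close>] by (simp add: b_def)
    define t where "t = - (h \<bullet> h) / b"
    have "t < 0" using pos b by (simp add: t_def field_simps)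
    have "2 * (h \<bullet> h) + t * (h \<bullet> B h) \<le> 0"
    proof -
      have "0 \<le> t * (2 * (h \<bullet> h) + t * (h \<bullet> B h))"
        using quad[of t] by (simp add: algebra_simps power2_eq_square)
      with \<open>t < 0\<close> show ?thesis by (simp add: zero_le_mult_iff)
    qed
    moreover have "t * (h \<bullet> B h) \<ge> t * b"
      using \<open>t < 0\<close> by (simp add: b_def)
    moreover have "t * b = - (h \<bullet> h)"
      using b by (simp add: t_def)
    ultimately show False using pos by linarith
  qed
  then have "A *v v = \<mu> *\<^sub>R v"
    by (simp add: h_def B_def)
  with v that show thesis by blast
qed

text \<open>Induction on \<open>I\<close>: the Hermitian complement of the eigenvectors found so far
  is invariant under \<open>A\<close> because \<open>A\<close> is self-adjoint with real
  eigenvalues, and it is nonzero as long as an index is missing.\<close>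

lemma hermitian_orthonormal_eigenvectors:
  fixes A :: "'k::conj_division_algebra^'n^'n" and I :: "'n set"
  assumes herm: "conj_transpose A = A"
  shows "\<exists>v \<mu>. (\<forall>i\<in>I. \<forall>j\<in>I. herm (v i) (v j) = (if i = j then 1 else 0)) \<and>
     (\<forall>i\<in>I. A *v v i = \<mu> i *\<^sub>R v i)"
  using finite[of I]
proof induction
  case (insert k I)
  then obtain v \<mu> where v: "\<And>i j. i \<in> I \<Longrightarrow> j \<in> I \<Longrightarrow> herm (v i) (v j) = (if i = j then 1 else 0)"
    and ev: "\<And>i. i \<in> I \<Longrightarrow> A *v v i = \<mu> i *\<^sub>R v i"
    by blast
  define W where "W = {x. \<forall>i\<in>I. herm (v i) x = 0}"
  have "I \<noteq> UNIV" using insert by auto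
  then obtain w where w: "w \<in> W" "w \<noteq> 0"
    using exists_herm_orthogonal[of I v] by (auto simp: W_def)
  have "subspace W"
    by (simp add: subspace_def W_def herm_add_right herm_scaleR_right)
  moreover have "A *v x \<in> W" if "x \<in> W" for x
    using that ev by (simp add: W_def herm_matrix_right herm herm_scaleR_left)
  ultimately obtain u \<nu> where u: "u \<in> W" "norm u = 1" "A *v u = \<nu> *\<^sub>R u"
    using hermitian_eigenvector_in_subspace[OF herm] w by metis
  have uu: "herm u u = 1"
    using u(2) by (simp add: herm_self dot_square_norm)
  have vu: "herm (v i) u = 0" "herm u (v i) = 0" if "i \<in> I" for i
  proof -
    show "herm (v i) u = 0" using u that by (simp add: W_def)
    then show "herm u (v i) = 0" by (metis conjugate_herm conjugate_zero)
  qed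
  show ?case
    using insert.hyps v ev u(3) uu vu
    by (intro exI[of _ "v(k := u)"] exI[of _ "\<mu>(k := \<nu>)"]) auto
qed simp

theorem hermitian_diagonalization:
  fixes A :: "'k::conj_division_algebra^'n^'n"
  assumes "conj_transpose A = A"
  obtains U \<mu> where "U \<in> unitary_group" "A ** U = U ** diagonal \<mu>"
proof -
  obtain v \<mu> where v: "\<And>i j :: 'n. herm (v i) (v j) = (if i = j then 1 else 0)"
    and ev: "\<And>i. A *v v i = \<mu> i *\<^sub>R v i"
    using hermitian_orthonormal_eigenvectors[OF assms, of UNIV] by auto
  define U where "U = (\<chi> i j. v j $ i)"
  have col: "column j U = v j" for j
    by (simp add: U_def column_def)
  have "conj_transpose U ** U = mat 1"
    by (simp add: vec_eq_iff conj_transpose_mult_nth col v mat_def)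
  moreover have "A ** U = U ** diagonal \<mu>"
  proof -
    have "(A ** U) $ i $ j = (U ** diagonal \<mu>) $ i $ j" for i j
    proof -
      have "(A ** U) $ i $ j = column j (A ** U) $ i"
        by (simp add: column_def)
      also have "\<dots> = \<mu> j *\<^sub>R v j $ i"
        by (simp only: column_matrix_mult col ev vector_scaleR_component)
      finally show ?thesis
        by (simp add: mult_diagonal_nth U_def)
    qed
    then show ?thesis by (simp add: vec_eq_iff)
  qed
  ultimately show thesis
    using that by (simp add: unitary_group_iff)
qed

section \<open>Multiplicities\<close>

text \<open>Multiplying each basis vector by a real basis of the scalars yields a real basis of
  \<open>S\<close>. So all right bases of \<open>S\<close> have the same size, and the choice made
  in \<open>right_dim\<close> does not affect its value.\<close>

lemma right_basis_card:
  fixes B :: "('k::conj_division_algebra^'n) set"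
  assumes "right_basis B S"
  shows "dim S = card B * DIM('k)"
proof -
  have "finite B" and ind: "\<And>c. (\<Sum>b\<in>B. right_scale b (c b)) = 0 \<Longrightarrow> \<forall>b\<in>B. c b = 0"
    and S: "S = range (\<lambda>c. \<Sum>b\<in>B. right_scale b (c b))"
    using assms by (auto simp: right_basis_def)
  define f :: "('k^'n) \<times> 'k \<Rightarrow> 'k^'n" where "f = (\<lambda>(b, e). right_scale b e)"
  define T where "T = f ` (B \<times> Basis)"
  have comb: "(\<Sum>p\<in>B \<times> Basis. r p *\<^sub>R f p) = (\<Sum>b\<in>B. right_scale b (\<Sum>e\<in>Basis. r (b, e) *\<^sub>R e))" for r
    by (simp add: f_def sum.cartesian_product linear_sum[OF linear_right_scale]
        linear_scale[OF linear_right_scale] case_prod_beta)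
  have zero: "r (b, e) = 0" if "(\<Sum>p\<in>B \<times> Basis. r p *\<^sub>R f p) = 0" "b \<in> B" "e \<in> Basis" for r b e
  proof -
    have "(\<Sum>e\<in>Basis. r (b, e) *\<^sub>R e) = 0"
      using ind[of "\<lambda>b. \<Sum>e\<in>Basis. r (b, e) *\<^sub>R e"] that by (simp add: comb)
    then have "(\<Sum>e\<in>Basis. r (b, e) *\<^sub>R e) \<bullet> e = 0" by simp
    then show ?thesis using that by (simp add: inner_sum_left_Basis)
  qed
  have inj: "inj_on f (B \<times> Basis)"
  proof (rule inj_onI, rule ccontr)
    fix p q assume pq: "p \<in> B \<times> Basis" "q \<in> B \<times> Basis" "f p = f q" "p \<noteq> q"
    define r where "r x = (if x = p then 1 else if x = q then - 1 else 0 :: real)" for x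
    have "(\<Sum>x\<in>B \<times> Basis. r x *\<^sub>R f x) = (\<Sum>x\<in>{p, q}. r x *\<^sub>R f x)"
      using pq \<open>finite B\<close> by (intro sum.mono_neutral_right) (auto simp: r_def)
    also have "\<dots> = 0" using pq by (simp add: r_def)
    finally have "r p = 0" using zero[of r "fst p" "snd p"] pq by auto
    then show False by (simp add: r_def)
  qed
  have "independent T"
  proof (rule independent_if_scalars_zero)
    show "finite T" using \<open>finite B\<close> by (simp add: T_def)
    fix g x assume *: "(\<Sum>x\<in>T. g x *\<^sub>R x) = 0" and "x \<in> T"
    then obtain b e where "b \<in> B" "e \<in> Basis" "x = f (b, e)" by (auto simp: T_def)
    with * zero[of "g \<circ> f" b e] show "g x = 0"
      by (simp add: T_def sum.reindex[OF inj])
  qed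
  moreover have "T \<subseteq> S"
  proof
    fix x assume "x \<in> T"
    then obtain b e where be: "b \<in> B" "x = right_scale b e" by (auto simp: T_def f_def)
    have "(\<Sum>b'\<in>B. right_scale b' (if b' = b then e else 0)) =
        (\<Sum>b'\<in>B. if b' = b then right_scale b e else 0)"
      by (intro sum.cong) (auto simp: right_scale_def vec_eq_iff)
    also have "\<dots> = x" using be \<open>finite B\<close> by simp
    finally show "x \<in> S" unfolding S
      by (intro range_eqI[of _ _ "\<lambda>b'. if b' = b then e else 0"]) simp
  qed
  moreover have "S \<subseteq> span T"
  proof
    fix x assume "x \<in> S"
    then obtain c where "x = (\<Sum>b\<in>B. right_scale b (c b))" by (auto simp: S)
    moreover have "right_scale b (c b) \<in> span T" if "b \<in> B" for b
    proof -
      have "right_scale b ` Basis \<subseteq> T" using that by (auto simp: T_def f_def)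
      then show ?thesis using right_scale_in_span_Basis span_mono by blast
    qed
    ultimately show "x \<in> span T" by (simp add: span_sum)
  qed
  ultimately have "dim S = card T"
    by (metis dim_unique)
  then show ?thesis
    by (simp add: T_def card_image[OF inj] card_cartesian_product)
qed

lemma right_dim_eqI:
  fixes B :: "('k::conj_division_algebra^'n) set"
  assumes "right_basis B S"
  shows "right_dim S = card B"
proof -
  have "right_basis (SOME B. right_basis B S) S"
    using assms by (rule someI)
  from right_basis_card[OF this] right_basis_card[OF assms] show ?thesis
    by (simp add: right_dim_def)
qed

text \<open>In the coordinates \<open>y\<close> given by the columns of \<open>U\<close>, the
  eigenvector equation reads \<open>\<mu> i *\<^sub>R y $ i = t *\<^sub>R y $ i\<close>, so exactly
  the coordinates with \<open>\<mu> i = t\<close> are free. Pairing with a column by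
  \<open>herm\<close> reads off its coefficient.\<close>

lemma eigen_multiplicity_diagonalized:
  fixes A U :: "'k::conj_division_algebra^'n^'n"
  assumes U: "U \<in> unitary_group" and AU: "A ** U = U ** diagonal \<mu>"
  shows "eigen_multiplicity A t = card {i. \<mu> i = t}"
proof -
  define B where "B = (\<lambda>j. column j U) ` {i. \<mu> i = t}"
  have ort: "herm (column i U) (column j U) = (if i = j then 1 else 0)" for i j
    using U by (simp add: unitary_group_iff mat_def flip: conj_transpose_mult_nth)
  have inj: "inj (\<lambda>j. column j U)"
    by (rule injI) (metis ort one_neq_zero)
  have sum_B: "(\<Sum>b\<in>B. right_scale b (c b)) = (\<Sum>j | \<mu> j = t. right_scale (column j U) (c (column j U)))" for c
    unfolding B_def by (subst sum.reindex) (use inj in \<open>auto intro: inj_on_subset\<close>)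
  have herm_sum: "herm x (sum f J) = (\<Sum>j\<in>J. herm x (f j))" for x f and J :: "'n set"
    by (induction J rule: infinite_finite_induct) (simp_all add: herm_add_right)
  have coeff: "herm (column i U) (\<Sum>j\<in>J. right_scale (column j U) (c j)) = (if i \<in> J then c i else 0)" for i c J
  proof -
    have "herm (column i U) (\<Sum>j\<in>J. right_scale (column j U) (c j)) = (\<Sum>j\<in>J. if i = j then c j else 0)"
      unfolding herm_sum herm_right_scale_right ort by (intro sum.cong) auto
    then show ?thesis by simp
  qed
  have U_vec: "U *v y = (\<Sum>j\<in>UNIV. right_scale (column j U) (y $ j))" for y
    by (simp add: matrix_vector_mult_def column_def right_scale_def vec_eq_iff)
  have eig: "A *v (U *v y) = t *\<^sub>R (U *v y) \<longleftrightarrow> (\<forall>i. \<mu> i \<noteq> t \<longrightarrow> y $ i = 0)" for y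
  proof -
    have inj_U: "inj ((*v) U)"
      by (rule injI) (metis U matrix_vector_mul_assoc matrix_vector_mul_lid unitary_group_iff)
    have "A *v (U *v y) = U *v (diagonal \<mu> *v y)"
      by (simp add: matrix_vector_mul_assoc AU)
    moreover have "t *\<^sub>R (U *v y) = U *v (t *\<^sub>R y)"
      by (simp add: linear_scale[OF linear_matrix_vector_mult])
    ultimately have "A *v (U *v y) = t *\<^sub>R (U *v y) \<longleftrightarrow> diagonal \<mu> *v y = t *\<^sub>R y"
      using inj_U by (simp add: inj_eq)
    then show ?thesis
      by (auto simp: vec_eq_iff diagonal_mult_vec_nth)
  qed
  have "right_basis B {x. A *v x = t *\<^sub>R x}"
    unfolding right_basis_def
  proof (intro conjI allI impI)
    show "finite B" by (simp add: B_def)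
  next
    fix c assume *: "(\<Sum>b\<in>B. right_scale b (c b)) = 0"
    show "\<forall>b\<in>B. c b = 0"
    proof
      fix b assume "b \<in> B"
      then obtain i where i: "\<mu> i = t" "b = column i U" by (auto simp: B_def)
      have "herm b (\<Sum>b\<in>B. right_scale b (c b)) = c b"
        using i by (simp add: sum_B coeff)
      with * show "c b = 0" by simp
    qed
  next
    show "{x. A *v x = t *\<^sub>R x} = range (\<lambda>c. \<Sum>b\<in>B. right_scale b (c b))"
    proof (intro subset_antisym subsetI)
      fix x assume "x \<in> {x. A *v x = t *\<^sub>R x}"
      moreover define y where "y = conj_transpose U *v x"
      have x: "x = U *v y"
        using U by (simp add: y_def matrix_vector_mul_assoc unitary_group_def)
      ultimately have y: "\<mu> i \<noteq> t \<longrightarrow> y $ i = 0" for i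
        using eig by simp
      \<comment> \<open>In \<open>right_basis\<close> coefficients are indexed by basis vectors, not
        by column numbers.\<close>
      define c where "c b = herm b x" for b
      have c: "c (column j U) = y $ j" for j
        by (simp add: c_def x U_vec coeff)
      have "x = (\<Sum>j | \<mu> j = t. right_scale (column j U) (y $ j))"
        unfolding x U_vec using y
        by (intro sum.mono_neutral_right) (auto simp: right_scale_def vec_eq_iff)
      then have "x = (\<Sum>b\<in>B. right_scale b (c b))"
        by (simp add: sum_B c)
      then show "x \<in> range (\<lambda>c. \<Sum>b\<in>B. right_scale b (c b))" by blast
    next
      fix x assume "x \<in> range (\<lambda>c. \<Sum>b\<in>B. right_scale b (c b))"
      then obtain c where x: "x = (\<Sum>b\<in>B. right_scale b (c b))" by blast
      define y where "y = (\<chi> i. if \<mu> i = t then c (column i U) else 0)"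
      have "x = U *v y"
        unfolding x sum_B U_vec
        by (intro sum.mono_neutral_cong_left) (auto simp: y_def right_scale_def vec_eq_iff)
      then show "x \<in> {x. A *v x = t *\<^sub>R x}"
        by (simp add: eig y_def)
    qed
  qed
  then have "eigen_multiplicity A t = card B"
    unfolding eigen_multiplicity_def by (rule right_dim_eqI)
  also have "\<dots> = card {i. \<mu> i = t}"
    unfolding B_def by (intro card_image inj_on_subset[OF inj]) simp
  finally show ?thesis .
qed

lemma ex_permutation_if_card_vimage_eq:
  fixes f g :: "'n::finite \<Rightarrow> 'a"
  assumes "\<And>t. card {i. f i = t} = card {i. g i = t}"
  obtains p where "p permutes UNIV" "\<And>i. f i = g (p i)"
proof -
  have "image_mset f (mset_set UNIV) = image_mset g (mset_set UNIV)"
    using assms by (intro multiset_eqI) (simp add: count_image_mset_eq_card_vimage)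
  then show thesis
    using image_mset_eq_implies_permutes[of UNIV f g] that by auto
qed

text \<open>\<open>D\<close> is tied to \<open>Y\<close> only through the multiplicities of its
  entries, whereas diagonalization lists the eigenvalues in an arbitrary order. Equal multiplicities
  provide a permutation matching the two lists.\<close>

theorem singular_value_matrix_diagonalization:
  fixes Y D :: "'k::conj_division_algebra^'n::{finite,linorder}^'n::_"
  assumes "singular_value_matrix Y D"
  obtains s U where "\<And>i. 0 \<le> s i" "D = diagonal s" "U \<in> unitary_group"
    "Y ** conj_transpose Y = U ** (D ** D) ** conj_transpose U"
proof -
  obtain s where s: "\<And>i. 0 \<le> s i" and D: "D = diagonal s"
    and mult: "\<And>t. 0 \<le> t \<Longrightarrow> card {i. s i = t} = eigen_multiplicity (Y ** conj_transpose Y) (t\<^sup>2)"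
    using assms by (auto simp: singular_value_matrix_def diagonal_def)
  define A where "A = Y ** conj_transpose Y"
  have "conj_transpose A = A"
    by (simp add: A_def conj_transpose_mult)
  then obtain U \<mu> where U: "U \<in> unitary_group" and AU: "A ** U = U ** diagonal \<mu>"
    by (rule hermitian_diagonalization)
  \<comment> \<open>For a unit eigenvector \<open>v\<close> the eigenvalue is
    \<open>v \<bullet> (A *v v)\<close>, the squared norm of
    \<open>conj_transpose Y *v v\<close>.\<close>
  have \<mu>: "0 \<le> \<mu> i" for i
  proof -
    define v where "v = column i U"
    have "column i (A ** U) = \<mu> i *\<^sub>R v"
      by (simp add: AU v_def column_def vec_eq_iff mult_diagonal_nth)
    then have "A *v v = \<mu> i *\<^sub>R v"
      by (simp add: column_matrix_mult v_def)
    moreover have "v \<bullet> (A *v v) = (conj_transpose Y *v v) \<bullet> (conj_transpose Y *v v)"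
      by (simp add: A_def inner_adjoint flip: matrix_vector_mul_assoc)
    moreover have "v \<bullet> v = 1"
    proof -
      have "herm v v = 1"
        using U by (simp add: unitary_group_iff v_def mat_def flip: conj_transpose_mult_nth)
      then show ?thesis by (simp add: herm_self)
    qed
    ultimately show ?thesis
      by (metis inner_ge_zero inner_scaleR_right mult.right_neutral)
  qed
  have "card {i. s i = t} = card {i. sqrt (\<mu> i) = t}" for t
  proof (cases "0 \<le> t")
    case True
    have "\<mu> i = t\<^sup>2 \<longleftrightarrow> sqrt (\<mu> i) = t" for i
      using True \<mu>[of i] by auto
    with True mult show ?thesis
      by (simp add: A_def[symmetric] eigen_multiplicity_diagonalized[OF U AU])
  next
    case False
    with s \<mu> show ?thesis by (smt (verit) card.empty Collect_cong empty_def real_sqrt_ge_zero)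
  qed
  then obtain p where p: "p permutes UNIV" "\<And>i. s i = sqrt (\<mu> (p i))"
    using ex_permutation_if_card_vimage_eq[of s "\<lambda>i. sqrt (\<mu> i)"] by blast
  \<comment> \<open>Permuting the columns of \<open>U\<close> puts the eigenvalues in the order of
    the diagonal of \<open>D\<close>.\<close>
  define P where "P = (\<chi> i j. U $ i $ p j)"
  have col: "column j P = column (p j) U" for j
    by (simp add: P_def column_def)
  have "conj_transpose P ** P = mat 1"
  proof -
    have "herm (column i U) (column j U) = (if i = j then 1 else 0)" for i j
      using U by (simp add: unitary_group_iff mat_def flip: conj_transpose_mult_nth)
    then show ?thesis
      using permutes_inj[OF p(1)]
      by (simp add: vec_eq_iff conj_transpose_mult_nth col mat_def inj_eq)
  qed
  then have P: "P \<in> unitary_group" by (simp add: unitary_group_iff)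
  have "(A ** P) $ i $ j = (P ** (D ** D)) $ i $ j" for i j
  proof -
    have "(A ** P) $ i $ j = (A ** U) $ i $ p j"
      by (simp add: matrix_matrix_mult_def P_def)
    also have "\<dots> = \<mu> (p j) *\<^sub>R P $ i $ j"
      by (simp add: AU mult_diagonal_nth P_def)
    also have "\<dots> = (P ** (D ** D)) $ i $ j"
      using \<mu>[of "p j"] by (simp add: D matrix_mul_assoc mult_diagonal_nth p(2))
    finally show ?thesis .
  qed
  then have "A ** P = P ** (D ** D)" by (simp add: vec_eq_iff)
  then have "A ** P ** conj_transpose P = P ** (D ** D) ** conj_transpose P"
    by simp
  then have "A = P ** (D ** D) ** conj_transpose P"
    using P by (simp add: unitary_group_def flip: matrix_mul_assoc)
  with that[OF s D P] show thesis by (simp only: A_def)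
qed

section \<open>Automorphisms of the matrix algebra\<close>

definition entrywise :: "('a \<Rightarrow> 'b) \<Rightarrow> 'a^'n^'m \<Rightarrow> 'b^'n^'m" where
  "entrywise f A = (\<chi> i j. f (A $ i $ j))"

lemma entrywise_nth [simp]: "entrywise f A $ i $ j = f (A $ i $ j)"
  by (simp add: entrywise_def)

lemma entrywise_ident [simp]: "entrywise (\<lambda>x. x) A = A"
  by (simp add: vec_eq_iff)

definition conj_automorphism :: "('k::conj_algebra \<Rightarrow> 'k) \<Rightarrow> bool" where
  "conj_automorphism \<phi> \<longleftrightarrow> linear \<phi> \<and> (\<forall>a b. \<phi> (a * b) = \<phi> a * \<phi> b) \<and> \<phi> 1 = 1 \<and>
     (\<forall>a. \<phi> (conjugate a) = conjugate (\<phi> a))"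

lemma conj_automorphism_ident: "conj_automorphism (\<lambda>x. x)"
  by (simp add: conj_automorphism_def linear_iff)

context
  fixes \<phi> :: "'k::conj_algebra \<Rightarrow> 'k"
  assumes \<phi>: "conj_automorphism \<phi>"
begin

lemma conj_automorphism_of_real [simp]: "\<phi> (of_real r) = of_real r"
  using \<phi> by (simp add: conj_automorphism_def of_real_def linear_scale)

lemma conj_automorphism_0 [simp]: "\<phi> 0 = 0" and conj_automorphism_1 [simp]: "\<phi> 1 = 1"
  using conj_automorphism_of_real[of 0] conj_automorphism_of_real[of 1] by simp_all

lemma entrywise_mult: "entrywise \<phi> (A ** B) = entrywise \<phi> A ** entrywise \<phi> B"
  using \<phi> by (simp add: conj_automorphism_def vec_eq_iff matrix_matrix_mult_def linear_sum)

lemma entrywise_add: "entrywise \<phi> (A + B) = entrywise \<phi> A + entrywise \<phi> B"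
  using \<phi> by (simp add: conj_automorphism_def vec_eq_iff linear_add)

lemma entrywise_conj_transpose: "entrywise \<phi> (conj_transpose A) = conj_transpose (entrywise \<phi> A)"
  using \<phi> by (simp add: conj_automorphism_def vec_eq_iff conj_transpose_def)

lemma entrywise_mat [simp]: "entrywise \<phi> (mat c) = mat (\<phi> c)"
  by (simp add: vec_eq_iff mat_def)

lemma entrywise_diagonal [simp]: "entrywise \<phi> (diagonal s) = diagonal s"
  by (simp add: vec_eq_iff diagonal_def)

end

section \<open>Scalar matrices and matrix units\<close>

lemma mat_mult_nth: "(mat c ** A) $ i $ j = c * A $ i $ j" for A :: "'k::semiring_1^'n^'n"
  by (simp add: mat_def matrix_matrix_mult_def if_distrib[of "\<lambda>x. x * _"] cong: if_cong)

lemma mult_mat_nth: "(A ** mat c) $ i $ j = A $ i $ j * c" for A :: "'k::semiring_1^'n^'n"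
  by (simp add: mat_def matrix_matrix_mult_def if_distrib[of "\<lambda>x. _ * x"] cong: if_cong)

lemma mat_mult_mat: "mat a ** mat b = (mat (a * b) :: 'k::semiring_1^'n^'n)"
  unfolding vec_eq_iff mat_mult_nth by (simp add: mat_def)

lemma conj_transpose_mat_conjugate: "conj_transpose (mat c) = mat (conjugate c)"
  by (simp add: conj_transpose_def mat_def vec_eq_iff)

lemma mat_eq_iff: "(mat a :: 'k::zero^'n^'n) = mat b \<longleftrightarrow> a = b"
  by (auto simp: mat_def vec_eq_iff)

definition matrix_unit :: "'m \<Rightarrow> 'n \<Rightarrow> 'k::zero \<Rightarrow> 'k^'n^'m" where
  "matrix_unit i j a = (\<chi> k l. if k = i \<and> l = j then a else 0)"

lemma matrix_unit_mult_nth: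
  "(matrix_unit i j a ** A) $ k $ l = (if k = i then a * A $ j $ l else 0)"
  for A :: "'k::semiring_1^'n^'m"
  by (simp add: matrix_unit_def matrix_matrix_mult_def if_distrib[of "\<lambda>x. x * _"] cong: if_cong)

lemma mult_matrix_unit_nth:
  "(A ** matrix_unit i j a) $ k $ l = (if l = j then A $ k $ i * a else 0)"
  for A :: "'k::semiring_1^'n^'m"
  by (simp add: matrix_unit_def matrix_matrix_mult_def if_distrib[of "\<lambda>x. _ * x"] cong: if_cong)

lemma matrix_unit_mult:
  "matrix_unit i j a ** matrix_unit k l b = (if j = k then matrix_unit i l (a * b) else 0)"
  for a b :: "'k::semiring_1"
  unfolding vec_eq_iff matrix_unit_mult_nth by (simp add: matrix_unit_def)

lemma conj_transpose_matrix_unit: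
  "conj_transpose (matrix_unit i j a) = matrix_unit j i (conjugate a)"
  by (auto simp: conj_transpose_def matrix_unit_def vec_eq_iff)

lemma matrix_sum_units: "A = (\<Sum>i\<in>UNIV. \<Sum>j\<in>UNIV. matrix_unit i j (A $ i $ j))"
  for A :: "'k::comm_monoid_add^'n^'m"
proof -
  have "(\<Sum>j\<in>UNIV. matrix_unit i j (A $ i $ j) $ k $ l) = (if k = i then A $ i $ l else 0)" for i k l
    by (cases "k = i") (simp_all add: matrix_unit_def)
  then show ?thesis by (simp add: vec_eq_iff)
qed

text \<open>The units carry the coefficient 1, so commuting with them constrains only the positions
  of the entries: off-diagonal ones vanish and diagonal ones agree. The common entry is not claimed
  to be central.\<close>

lemma commutes_with_units_imp_scalar:
  fixes A :: "'k::semiring_1^'n^'n"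
  assumes "\<And>k l. A ** matrix_unit k l 1 = matrix_unit k l 1 ** A"
  shows "A = mat (A $ i $ i)"
proof -
  have *: "(if j = l then A $ i $ k else 0) = (if i = k then A $ l $ j else 0)" for i j k l
    using arg_cong[OF assms[of k l], of "\<lambda>B. B $ i $ j"]
    by (simp only: mult_matrix_unit_nth matrix_unit_mult_nth mult_1_right mult_1_left)
  have "A $ k $ l = (if k = l then A $ i $ i else 0)" for k l
  proof (cases "k = l")
    case True
    with *[where i=k and j=i and k=k and l=i] show ?thesis by (simp only: simp_thms if_True)
  next
    case False
    with *[where i=k and j=i and k=l and l=i] show ?thesis by (simp only: simp_thms if_True if_False)
  qed
  then show ?thesis unfolding vec_eq_iff mat_def vec_lambda_beta by blast
qed

section \<open>Normal form of an involution compatible with the adjoint\<close>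

locale star_involution =
  fixes \<sigma> :: "'k::conj_division_algebra^'n^'n \<Rightarrow> 'k^'n^'n"
  assumes involutive: "involutive_automorphism \<sigma>"
    and star: "\<sigma> (conj_transpose X) = conj_transpose (\<sigma> X)"
begin

lemma linear: "linear \<sigma>" and mult: "\<sigma> (A ** B) = \<sigma> A ** \<sigma> B" and one [simp]: "\<sigma> (mat 1) = mat 1"
    and invol [simp]: "\<sigma> (\<sigma> A) = A"
  using involutive by (simp_all add: involutive_automorphism_def)

text \<open>The columns of \<open>S\<close> are permuted by the images of the matrix units exactly
  as the standard basis is by the units. Undoing \<open>S\<close> therefore leaves an automorphism
  that fixes all units, and such an automorphism can only act on the scalars.\<close>

theorem skolem_noether:
  obtains S \<phi> where "S \<in> unitary_group" "conj_automorphism \<phi>"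
    "\<And>X. \<sigma> X = S ** entrywise \<phi> X ** conj_transpose S"
proof -
  obtain i :: 'n where True by simp
  define E :: "'n \<Rightarrow> 'n \<Rightarrow> 'k^'n^'n" where "E j k = matrix_unit j k 1" for j k
  have E_mult: "E j k ** E l m = (if k = l then E j m else 0)" for j k l m
    by (simp add: E_def matrix_unit_mult)
  have \<sigma>_0 [simp]: "\<sigma> 0 = 0" using linear by (rule linear_0)
  have "E i i \<noteq> 0" by (auto simp: E_def matrix_unit_def vec_eq_iff)
  then have "\<sigma> (E i i) \<noteq> 0" by (metis \<sigma>_0 invol)
  then obtain x where x: "\<sigma> (E i i) *v x \<noteq> 0"
    by (auto simp: matrix_eq_iff_vec)
  define w where "w = inverse (norm (\<sigma> (E i i) *v x)) *\<^sub>R (\<sigma> (E i i) *v x)"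
  have w: "\<sigma> (E i i) *v w = w"
    by (simp add: w_def linear_scale[OF linear_matrix_vector_mult] matrix_vector_mul_assoc
        E_mult flip: mult)
  have "norm w = 1" using x by (simp add: w_def)
  then have ww: "herm w w = 1" by (simp add: herm_self dot_square_norm)
  \<comment> \<open>The products of two columns reduce to
    \<open>herm w (\<sigma> (E i j ** E k i) *v w)\<close>, where the unit product is 0 or
    \<open>E i i\<close>, whose image fixes \<open>w\<close>.\<close>
  define S where "S = (\<chi> k j. (\<sigma> (E j i) *v w) $ k)"
  have col: "column j S = \<sigma> (E j i) *v w" for j
    by (simp add: S_def column_def)
  have "herm (column j S) (column k S) = (if j = k then 1 else 0)" for j k
  proof -
    have "herm (column j S) (column k S) = herm w (conj_transpose (\<sigma> (E j i)) *v (\<sigma> (E k i) *v w))"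
      by (simp add: col herm_matrix_right)
    also have "\<dots> = herm w (\<sigma> (E i j ** E k i) *v w)"
      by (simp add: mult matrix_vector_mul_assoc E_def conj_transpose_matrix_unit flip: star)
    finally show ?thesis
      by (simp add: E_mult w ww)
  qed
  then have "conj_transpose S ** S = mat 1"
    by (simp add: vec_eq_iff conj_transpose_mult_nth mat_def)
  then have S: "S \<in> unitary_group" by (simp add: unitary_group_iff)
  then have S1: "conj_transpose S ** S = mat 1" and S2: "S ** conj_transpose S = mat 1"
    by (simp_all add: unitary_group_iff[symmetric] unitary_group_def[symmetric])
      (simp add: unitary_group_def)
  have "column m (\<sigma> (E j k) ** S) = column m (S ** E j k)" for j k m
  proof -
    have "column m (\<sigma> (E j k) ** S) = (if k = m then column j S else 0)"
      by (simp add: column_matrix_mult col matrix_vector_mul_assoc E_mult flip: mult)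
    also have "\<dots> = column m (S ** E j k)"
      by (auto simp: column_def vec_eq_iff E_def mult_matrix_unit_nth)
    finally show ?thesis .
  qed
  then have SE: "\<sigma> (E j k) ** S = S ** E j k" for j k
    by (simp add: column_def vec_eq_iff)
  \<comment> \<open>Fixing every matrix unit, \<open>\<rho>\<close> preserves the matrices commuting
    with them, which are the scalar ones. Its action there is the map \<open>\<phi>\<close>.\<close>
  define \<rho> where "\<rho> X = conj_transpose S ** \<sigma> X ** S" for X
  have \<rho>_E: "\<rho> (E j k) = E j k" for j k
    by (simp add: \<rho>_def SE S1 matrix_mul_assoc flip: matrix_mul_assoc[of _ "\<sigma> _"])
  have \<rho>_mult: "\<rho> (X ** Z) = \<rho> X ** \<rho> Z" for X Z
  proof -
    have "\<rho> X ** \<rho> Z = conj_transpose S ** \<sigma> X ** (S ** conj_transpose S) ** \<sigma> Z ** S"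
      by (simp only: \<rho>_def matrix_mul_assoc)
    then show ?thesis by (simp add: S2 \<rho>_def mult matrix_mul_assoc)
  qed
  have \<rho>_star: "\<rho> (conj_transpose X) = conj_transpose (\<rho> X)" for X
    by (simp add: \<rho>_def star conj_transpose_mult matrix_mul_assoc)
  have \<rho>_one: "\<rho> (mat 1) = mat 1" by (simp add: \<rho>_def S1)
  have \<rho>_linear: "linear \<rho>"
  proof -
    have "\<rho> = (\<lambda>A. A ** S) \<circ> ((**) (conj_transpose S) \<circ> \<sigma>)"
      by (simp add: \<rho>_def fun_eq_iff)
    then show ?thesis
      by (simp add: linear linear_matrix_mult_left linear_matrix_mult_right linear_compose)
  qed
  define \<phi> where "\<phi> c = \<rho> (mat c) $ i $ i" for c
  have \<phi>: "\<rho> (mat c) = mat (\<phi> c)" for c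
    unfolding \<phi>_def
  proof (rule commutes_with_units_imp_scalar)
    fix k l
    have "mat c ** E k l = E k l ** mat c"
      unfolding vec_eq_iff mat_mult_nth mult_mat_nth by (simp add: E_def matrix_unit_def)
    then show "\<rho> (mat c) ** matrix_unit k l 1 = matrix_unit k l 1 ** \<rho> (mat c)"
      using \<rho>_mult[of "mat c" "E k l"] \<rho>_mult[of "E k l" "mat c"] by (simp add: \<rho>_E flip: E_def)
  qed
  have "conj_automorphism \<phi>"
    unfolding conj_automorphism_def
  proof (intro conjI allI)
    show "linear \<phi>"
    proof (rule linearI)
      fix a b r
      have "mat (a + b) = (mat a + mat b :: 'k^'n^'n)" "mat (r *\<^sub>R a) = (r *\<^sub>R mat a :: 'k^'n^'n)"
        by (simp_all add: mat_def vec_eq_iff)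
      then show "\<phi> (a + b) = \<phi> a + \<phi> b" "\<phi> (r *\<^sub>R a) = r *\<^sub>R \<phi> a"
        by (simp_all add: \<phi>_def linear_add[OF \<rho>_linear] linear_scale[OF \<rho>_linear])
    qed
    show "\<phi> (a * b) = \<phi> a * \<phi> b" for a b
      using \<rho>_mult[of "mat a" "mat b"] by (simp add: mat_mult_mat \<phi> mat_eq_iff)
    show "\<phi> 1 = 1" using \<rho>_one by (simp add: \<phi> mat_eq_iff)
    show "\<phi> (conjugate a) = conjugate (\<phi> a)" for a
      using \<rho>_star[of "mat a"] by (simp add: conj_transpose_mat_conjugate \<phi> mat_eq_iff)
  qed
  moreover have "\<sigma> X = S ** entrywise \<phi> X ** conj_transpose S" for X
  proof -
    have unit: "\<rho> (matrix_unit j k a) = matrix_unit j k (\<phi> a)" for j k a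
    proof -
      have "matrix_unit j k c = mat c ** E j k" for c :: 'k
        unfolding vec_eq_iff mat_mult_nth by (simp add: E_def matrix_unit_def)
      then show ?thesis by (simp add: \<rho>_mult \<rho>_E \<phi>)
    qed
    have "\<rho> X = (\<Sum>j\<in>UNIV. \<Sum>k\<in>UNIV. matrix_unit j k (\<phi> (X $ j $ k)))"
      by (subst matrix_sum_units[of X]) (simp only: linear_sum[OF \<rho>_linear] unit)
    also have "\<dots> = entrywise \<phi> X"
      by (subst matrix_sum_units[of "entrywise \<phi> X"]) simp
    finally have "entrywise \<phi> X = conj_transpose S ** \<sigma> X ** S"
      by (simp add: \<rho>_def)
    then have "S ** entrywise \<phi> X ** conj_transpose S =
        (S ** conj_transpose S) ** \<sigma> X ** (S ** conj_transpose S)"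
      by (simp only: matrix_mul_assoc)
    then show ?thesis by (simp add: S2)
  qed
  ultimately show thesis using that S by blast
qed

text \<open>Applying \<sigma> twice conjugates by \<open>S ** entrywise \<phi> S\<close>, since
  \<phi> is an involution. As \<sigma> is one too, this matrix commutes with everything and is a
  central scalar, of modulus one by unitarity.\<close>

lemma cocycle_scalar:
  assumes S: "S \<in> unitary_group" and \<phi>: "conj_automorphism \<phi>" "\<And>a. \<phi> (\<phi> a) = a"
    and \<sigma>: "\<And>X. \<sigma> X = S ** entrywise \<phi> X ** conj_transpose S"
  obtains \<kappa> where "S ** entrywise \<phi> S = mat \<kappa>" "\<phi> \<kappa> = \<kappa>" "\<And>a. a * \<kappa> = \<kappa> * a" "\<kappa> * conjugate \<kappa> = 1"
proof -
  define T where "T = S ** entrywise \<phi> S"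
  have \<phi>\<phi>: "entrywise \<phi> (entrywise \<phi> X) = X" for X
    by (simp add: vec_eq_iff \<phi>(2))
  have "entrywise \<phi> S \<in> unitary_group"
    using S by (simp add: unitary_group_def flip: entrywise_mult[OF \<phi>(1)] entrywise_conj_transpose[OF \<phi>(1)])
      (simp add: \<phi>(1))
  then have T: "T \<in> unitary_group"
    unfolding T_def by (rule unitary_group_mult[OF S])
  have "X ** T = T ** X" for X
  proof -
    have "X = \<sigma> (\<sigma> X)" by simp
    also have "\<dots> = T ** X ** conj_transpose T"
      by (simp add: \<sigma> T_def entrywise_mult[OF \<phi>(1)] entrywise_conj_transpose[OF \<phi>(1)] \<phi>\<phi>
          conj_transpose_mult matrix_mul_assoc)
    finally have "X ** T = T ** X ** (conj_transpose T ** T)"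
      by (metis matrix_mul_assoc)
    then show ?thesis using T by (simp add: unitary_group_iff)
  qed
  note comm = this
  fix i :: 'n
  define \<kappa> where "\<kappa> = T $ i $ i"
  have T\<kappa>: "T = mat \<kappa>"
    unfolding \<kappa>_def by (rule commutes_with_units_imp_scalar) (simp add: comm)
  have central: "a * \<kappa> = \<kappa> * a" for a
    using comm[of "mat a"] by (simp add: T\<kappa> mat_mult_mat mat_eq_iff)
  have "\<kappa> * conjugate \<kappa> = 1"
    using T by (simp add: unitary_group_def T\<kappa> conj_transpose_mat_conjugate mat_mult_mat mat_eq_iff)
  \<comment> \<open>The product of \<open>S\<close>, \<open>entrywise \<phi> S\<close> and
    \<open>S\<close> is bracketed in two ways: as \<open>T ** S\<close>, and as
    \<open>S ** entrywise \<phi> T\<close>.\<close>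
  moreover have "\<phi> \<kappa> = \<kappa>"
  proof -
    have "S ** mat \<kappa> = mat \<kappa> ** S"
      unfolding vec_eq_iff mat_mult_nth mult_mat_nth by (simp add: central)
    also have "\<dots> = S ** entrywise \<phi> (S ** entrywise \<phi> S)"
      unfolding T\<kappa>[symmetric] T_def by (simp only: entrywise_mult[OF \<phi>(1)] \<phi>\<phi> matrix_mul_assoc)
    also have "\<dots> = S ** mat (\<phi> \<kappa>)"
      using T\<kappa> by (simp add: T_def \<phi>(1))
    finally have "conj_transpose S ** S ** mat \<kappa> = conj_transpose S ** S ** mat (\<phi> \<kappa>)"
      by (metis matrix_mul_assoc)
    then show ?thesis using S by (simp add: unitary_group_iff mat_eq_iff)
  qed
  ultimately show thesis using that[of \<kappa>] T\<kappa> central by (simp add: T_def)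
qed

end

section \<open>Symmetric singular value decompositions\<close>

text \<open>
  \<open>J\<close> is a unitary matrix on the coordinate subspace of \<open>N\<close> that solves there the same
  equation as \<open>S\<close> does on the whole space.
\<close>

definition block_root :: "('k::conj_algebra \<Rightarrow> 'k) \<Rightarrow> real \<Rightarrow> 'n::finite set \<Rightarrow> 'k^'n^'n \<Rightarrow> bool" where
  "block_root \<phi> \<epsilon> N J \<longleftrightarrow> (\<forall>i j. i \<notin> N \<or> j \<notin> N \<longrightarrow> J $ i $ j = 0) \<and>
     J ** conj_transpose J = diagonal (indicat_real N) \<and> entrywise \<phi> J = \<epsilon> *\<^sub>R conj_transpose J"

text \<open>\<open>S\<close> and \<phi> encode the semilinear map x |-> S \<phi>(x). When \<phi> is
  an involution, \<sigma> is conjugation by this map and \<epsilon> is its square, so that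
  \<epsilon> = 1 resembles a real structure and \<epsilon> = -1 a quaternionic one.\<close>

definition twisted_frame ::
  "('k::conj_algebra^'n^'n \<Rightarrow> 'k^'n^'n) \<Rightarrow> 'k^'n^'n \<Rightarrow> ('k \<Rightarrow> 'k) \<Rightarrow> real \<Rightarrow> bool" where
  "twisted_frame \<sigma> S \<phi> \<epsilon> \<longleftrightarrow> S \<in> unitary_group \<and> conj_automorphism \<phi> \<and> (\<epsilon> = 1 \<or> \<epsilon> = - 1) \<and>
     (\<forall>X. \<sigma> X = S ** entrywise \<phi> X ** conj_transpose S) \<and> S ** entrywise \<phi> S = \<epsilon> *\<^sub>R mat 1"

context star_involution
begin

lemma unitary: "U \<in> unitary_group \<Longrightarrow> \<sigma> U \<in> unitary_group"
  by (simp add: unitary_group_def flip: star mult)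

text \<open>The hypothesis \<open>root\<close> isolates the one step that depends on the scalars:
  solving the equation on the kernel. Its premise supplies a matrix \<open>G\<close> from which the
  dimension of the kernel can be controlled.\<close>

theorem symmetric_svd:
  assumes frame: "twisted_frame \<sigma> S \<phi> \<epsilon>"
    and Y: "\<sigma> Y = conj_transpose Y" and s: "\<And>i. 0 \<le> s i" and U: "U \<in> unitary_group"
    and YY: "Y ** conj_transpose Y = U ** (diagonal s ** diagonal s) ** conj_transpose U"
    and root: "\<And>N (G :: 'k^'n^'n). G ** entrywise \<phi> G = diagonal (\<lambda>i. if i \<in> N then 1 else \<epsilon>) \<Longrightarrow>
      \<exists>J. block_root \<phi> \<epsilon> N J"
  obtains V where "V \<in> unitary_group" "Y = U ** diagonal s ** conj_transpose V"
    "\<sigma> (conj_transpose U ** \<sigma> V) = conj_transpose (conj_transpose U ** \<sigma> V)"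
proof -
  have S: "S \<in> unitary_group" and \<phi>: "conj_automorphism \<phi>" and \<epsilon>: "\<epsilon> = 1 \<or> \<epsilon> = - 1"
    and \<sigma>: "\<And>X. \<sigma> X = S ** entrywise \<phi> X ** conj_transpose S"
    and S_\<phi>S: "S ** entrywise \<phi> S = \<epsilon> *\<^sub>R mat 1"
    using frame by (auto simp: twisted_frame_def)
  have [simp]: "\<epsilon> * \<epsilon> = 1" using \<epsilon> by auto
  have unitary_simps: "conj_transpose A ** A = mat 1" "A ** conj_transpose A = mat 1"
    if "A \<in> unitary_group" for A :: "'k^'n^'n"
    using that unitary_group_iff[of A] by (simp_all add: unitary_group_def)
  note SS = unitary_simps[OF S] and UU = unitary_simps[OF U]
    and \<sigma>U = unitary_simps[OF unitary[OF U]]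
  have S_cancel: "X ** conj_transpose S ** S = X" "X ** S ** conj_transpose S = X"
    and U_cancel: "X ** conj_transpose U ** U = X" "X ** U ** conj_transpose U = X"
    and \<sigma>U_cancel: "X ** conj_transpose (\<sigma> U) ** \<sigma> U = X" "X ** \<sigma> U ** conj_transpose (\<sigma> U) = X" for X
    by (simp_all add: SS UU \<sigma>U flip: matrix_mul_assoc)
  have \<phi>S: "entrywise \<phi> S = \<epsilon> *\<^sub>R conj_transpose S"
  proof -
    have "entrywise \<phi> S = conj_transpose S ** (S ** entrywise \<phi> S)"
      by (simp add: matrix_mul_assoc SS)
    then show ?thesis by (simp add: S_\<phi>S matrix_mult_scaleR)
  qed
  define D where "D = (diagonal s :: 'k^'n^'n)"
  \<comment> \<open>With \<sigma>(U) on the right, applying \<sigma> exchanges the two outer factors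
    up to adjoints, so \<open>\<sigma> M\<close> is the adjoint of \<open>M\<close>.\<close>
  define M where "M = conj_transpose U ** Y ** \<sigma> U"
  define H where "H = M ** S"
  have \<phi>D: "entrywise \<phi> D = D"
    by (simp add: D_def \<phi>)
  have HH: "H ** conj_transpose H = D ** D"
  proof -
    have "H ** conj_transpose H = conj_transpose U ** (Y ** conj_transpose Y) ** U"
      by (simp add: H_def M_def conj_transpose_mult matrix_mul_assoc S_cancel \<sigma>U_cancel)
    also have "\<dots> = D ** D"
      by (simp add: YY D_def[symmetric] matrix_mul_assoc UU U_cancel)
    finally show ?thesis .
  qed
  have \<sigma>M: "\<sigma> M = conj_transpose M"
    by (simp add: M_def mult star Y conj_transpose_mult matrix_mul_assoc)
  have \<phi>H: "entrywise \<phi> H = \<epsilon> *\<^sub>R conj_transpose H"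
  proof -
    have "S ** entrywise \<phi> M = conj_transpose M ** S"
      using \<sigma>M S_cancel(1)[of "S ** entrywise \<phi> M"] by (simp add: \<sigma>)
    then have "entrywise \<phi> M = conj_transpose S ** conj_transpose M ** S"
      by (metis SS(1) matrix_mul_assoc matrix_mul_lid)
    then show ?thesis
      by (simp add: H_def entrywise_mult[OF \<phi>] \<phi>S matrix_mult_scaleR S_cancel conj_transpose_mult)
  qed
  have H_star: "conj_transpose H = \<epsilon> *\<^sub>R entrywise \<phi> H"
    by (simp add: \<phi>H)
  \<comment> \<open>The two factors \<epsilon> cancel, so this product is the image of
    \<open>H ** conj_transpose H\<close> under \<phi>, and \<phi> fixes the real matrix
    \<open>D\<close>.\<close>
  have HH': "conj_transpose H ** H = D ** D"
  proof -
    have "H = \<epsilon> *\<^sub>R conj_transpose (entrywise \<phi> H)"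
      using arg_cong[OF H_star, of conj_transpose] by (simp add: conj_transpose_scaleR)
    then have "conj_transpose H ** H =
        conj_transpose H ** (\<epsilon> *\<^sub>R conj_transpose (entrywise \<phi> H))"
      by simp
    also have "\<dots> = entrywise \<phi> H ** conj_transpose (entrywise \<phi> H)"
      unfolding H_star by (simp add: scaleR_matrix_mult matrix_mult_scaleR)
    also have "\<dots> = entrywise \<phi> (H ** conj_transpose H)"
      by (simp only: entrywise_mult[OF \<phi>] entrywise_conj_transpose[OF \<phi>])
    also have "\<dots> = D ** D"
      by (simp add: HH entrywise_mult[OF \<phi>] \<phi>D)
    finally show ?thesis .
  qed
  \<comment> \<open>Bracketing H H* H in two ways shows that \<open>H\<close> commutes with the
    square of \<open>D\<close>. Since the \<open>s i\<close> are nonnegative, their squares separate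
    them.\<close>
  have H_block: "H $ i $ j = 0" if "s i \<noteq> s j" for i j
  proof -
    have "H ** (D ** D) = D ** D ** H"
      using HH HH' by (metis matrix_mul_assoc)
    from arg_cong[OF this, of "\<lambda>A. A $ i $ j"]
    have "(s j * s j) *\<^sub>R H $ i $ j = (s i * s i) *\<^sub>R H $ i $ j"
      by (simp add: D_def diagonal_mult_diagonal diagonal_mult_nth mult_diagonal_nth)
    moreover have "s j * s j \<noteq> s i * s i"
      using that s[of i] s[of j] by (metis power2_eq_square power2_eq_iff_nonneg)
    ultimately show ?thesis by simp
  qed
  have H_0: "H $ i $ j = 0" if "s j = 0" for i j
  proof -
    have "herm (column j H) (column j H) = 0"
      using arg_cong[OF HH', of "\<lambda>A. A $ j $ j"] that
      by (simp add: conj_transpose_mult_nth D_def diagonal_mult_diagonal diagonal_nth)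
    then have "column j H = 0" by (simp add: herm_self)
    then show ?thesis by (simp add: column_def vec_eq_iff)
  qed
  define N where "N = {i. s i = 0}"
  \<comment> \<open>The convention that \<open>inverse 0\<close> is 0 makes this the pseudoinverse
    of \<open>D\<close>, so \<open>H'\<close> vanishes on the kernel.\<close>
  define D' where "D' = (diagonal (\<lambda>i. inverse (s i)) :: 'k^'n^'n)"
  define P where "P = (diagonal (indicat_real N) :: 'k^'n^'n)"
  define H' where "H' = D' ** H"
  have H'_0: "H' $ i $ j = 0" if "i \<in> N \<or> j \<in> N" for i j
    using that H_0[of j i] by (auto simp: H'_def D'_def diagonal_mult_nth N_def)
  have HH'': "H' ** conj_transpose H' = diagonal (\<lambda>i. if i \<in> N then 0 else 1)"
  proof -
    have "H' ** conj_transpose H' = D' ** (H ** conj_transpose H) ** D'"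
      by (simp add: H'_def conj_transpose_mult matrix_mul_assoc D'_def)
    also have "\<dots> = diagonal (\<lambda>i. inverse (s i) * (s i * s i) * inverse (s i))"
      by (simp add: HH D'_def D_def diagonal_mult_diagonal)
    also have "(\<lambda>i. inverse (s i) * (s i * s i) * inverse (s i)) = (\<lambda>i. if i \<in> N then 0 else 1)"
      by (simp add: N_def fun_eq_iff field_simps)
    finally show ?thesis .
  qed
  have \<phi>H': "entrywise \<phi> H' = \<epsilon> *\<^sub>R conj_transpose H'"
  proof -
    have "D' ** conj_transpose H = conj_transpose H ** D'"
    proof -
      have "(D' ** conj_transpose H) $ i $ j = (conj_transpose H ** D') $ i $ j" for i j
        using H_block[of j i]
        by (cases "s i = s j") (simp_all add: D'_def diagonal_mult_nth mult_diagonal_nth conj_transpose_def)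
      then show ?thesis by (simp add: vec_eq_iff)
    qed
    then show ?thesis
      by (simp add: H'_def entrywise_mult[OF \<phi>] \<phi>H matrix_mult_scaleR conj_transpose_mult D'_def \<phi>)
  qed
  have ortho: "H' ** conj_transpose J = 0" "J ** conj_transpose H' = 0"
    if "\<And>i j. i \<notin> N \<or> j \<notin> N \<Longrightarrow> J $ i $ j = 0" for J
  proof -
    show "H' ** conj_transpose J = 0"
    proof -
      have "H' $ i $ k * conjugate (J $ j $ k) = 0" for i j k
        by (cases "k \<in> N") (simp_all add: H'_0 that)
      then show ?thesis
        by (simp add: vec_eq_iff matrix_matrix_mult_def conj_transpose_def)
    qed
    then have "conj_transpose (H' ** conj_transpose J) = 0" by simp
    then show "J ** conj_transpose H' = 0" by (simp add: conj_transpose_mult)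
  qed
  have P_0: "P $ i $ j = 0" if "i \<notin> N \<or> j \<notin> N" for i j
    using that by (auto simp: P_def diagonal_def)
  have "conj_transpose P = P" "entrywise \<phi> P = P"
    by (simp_all add: P_def \<phi>)
  \<comment> \<open>\<open>H'\<close> is completed by the identity on the kernel. The mixed products
    vanish, and the result has 1 on \<open>N\<close> and \<epsilon> elsewhere, as
    \<open>root\<close> requires.\<close>
  then have "(P + H') ** entrywise \<phi> (P + H') = P ** P + \<epsilon> *\<^sub>R (H' ** conj_transpose H')"
    using ortho[OF P_0]
    by (simp add: entrywise_add[OF \<phi>] matrix_add_ldistrib matrix_add_rdistrib \<phi>H' matrix_mult_scaleR)
  also have "\<dots> = diagonal (\<lambda>i. if i \<in> N then 1 else \<epsilon>)"
    unfolding HH'' P_def diagonal_mult_diagonal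
    by (auto simp: vec_eq_iff diagonal_def of_real_def)
  finally have "\<exists>J. block_root \<phi> \<epsilon> N J" by (rule root)
  then obtain J where J: "block_root \<phi> \<epsilon> N J" by blast
  then have J_0: "\<And>i j. i \<notin> N \<or> j \<notin> N \<Longrightarrow> J $ i $ j = 0"
    and JJ: "J ** conj_transpose J = P" and \<phi>J: "entrywise \<phi> J = \<epsilon> *\<^sub>R conj_transpose J"
    by (auto simp: block_root_def P_def)
  define G where "G = J + H'"
  have "G ** conj_transpose G = P + diagonal (\<lambda>i. if i \<in> N then 0 else 1)"
    using ortho[OF J_0]
    by (simp add: G_def conj_transpose_add matrix_add_ldistrib matrix_add_rdistrib JJ HH'')
  also have "\<dots> = mat 1"
    by (simp add: P_def diagonal_def mat_def vec_eq_iff)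
  finally have G: "G \<in> unitary_group" by (simp add: unitary_group_def)
  have DG: "D ** G = H"
  proof -
    have "(D ** G) $ i $ j = H $ i $ j" for i j
    proof (cases "s i = 0")
      case True
      then show ?thesis
        using H_0[of j i] H_block[of i j] by (cases "s j = 0") (simp_all add: D_def diagonal_mult_nth)
    next
      case False
      then show ?thesis
        using J_0[of i j] by (simp add: D_def G_def H'_def D'_def diagonal_mult_nth N_def)
    qed
    then show ?thesis by (simp add: vec_eq_iff)
  qed
  have \<phi>G: "entrywise \<phi> G = \<epsilon> *\<^sub>R conj_transpose G"
    by (simp add: G_def entrywise_add[OF \<phi>] \<phi>J \<phi>H' conj_transpose_add scaleR_add_right)
  define \<Theta> where "\<Theta> = G ** conj_transpose S"
  have \<sigma>\<Theta>: "\<sigma> \<Theta> = conj_transpose \<Theta>"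
    by (simp add: \<sigma> \<Theta>_def entrywise_mult[OF \<phi>] entrywise_conj_transpose[OF \<phi>] \<phi>S \<phi>G
        conj_transpose_scaleR scaleR_matrix_mult matrix_mult_scaleR conj_transpose_mult
        matrix_mul_assoc S_cancel)
  \<comment> \<open>Obtained by solving \<Theta> = U* \<sigma>(V) for \<open>V\<close>, using that
    \<sigma> sends \<Theta> to its adjoint.\<close>
  define V where "V = \<sigma> U ** conj_transpose \<Theta>"
  have "\<Theta> \<in> unitary_group"
    unfolding \<Theta>_def by (intro unitary_group_mult unitary_group_conj_transpose G S)
  then have V: "V \<in> unitary_group"
    unfolding V_def by (intro unitary_group_mult unitary_group_conj_transpose unitary U)
  have "U ** diagonal s ** conj_transpose V = U ** (D ** G) ** conj_transpose S ** conj_transpose (\<sigma> U)"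
    by (simp add: V_def conj_transpose_mult D_def \<Theta>_def matrix_mul_assoc)
  also have "\<dots> = (U ** conj_transpose U) ** Y"
    by (simp add: DG H_def M_def matrix_mul_assoc S_cancel \<sigma>U_cancel)
  finally have "Y = U ** diagonal s ** conj_transpose V"
    by (simp add: UU)
  moreover have "conj_transpose U ** \<sigma> V = \<Theta>"
    by (simp add: V_def mult star \<sigma>\<Theta> matrix_mul_assoc UU)
  ultimately show thesis
    using that V \<sigma>\<Theta> by simp
qed

end

section \<open>Roots on the kernel\<close>

lemma block_root_1:
  assumes "conj_automorphism \<phi>"
  shows "block_root \<phi> 1 N (diagonal (indicat_real N))"
proof -
  have "(\<lambda>i. indicat_real N i * indicat_real N i) = indicat_real N"
    by (auto simp: indicator_def)
  then show ?thesis
    by (simp add: block_root_def entrywise_diagonal[OF assms] diagonal_mult_diagonal diagonal_nth)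
qed

text \<open>Pairing the elements of \<open>N\<close> allows a direct sum of 2 by 2 rotations by a
  right angle. Its entries are real, hence fixed by \<phi>, and it is skew, which is the equation
  for \<epsilon> = -1.\<close>

lemma block_root_even:
  fixes \<phi> :: "'k::conj_algebra \<Rightarrow> 'k" and N :: "'n::finite set"
  assumes \<phi>: "conj_automorphism \<phi>" and "even (card N)"
  shows "\<exists>J. block_root \<phi> (- 1) N J"
proof -
  obtain h where h: "bij_betw h {0..<card N} N"
    using ex_bij_betw_nat_finite[of N] by auto
  define g where "g = inv_into {0..<card N} h"
  have g: "g i < card N" "h (g i) = i" if "i \<in> N" for i
    using h that bij_betw_inv_into_right[OF h] bij_betwE[OF bij_betw_inv_into[OF h]]
    by (auto simp: g_def)
  have gh: "g (h n) = n" "h n \<in> N" if "n < card N" for n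
    using h that bij_betw_inv_into_left[OF h] bij_betwE[OF h] by (auto simp: g_def)
  \<comment> \<open>Swaps 2m and 2m+1; an even \<open>card N\<close> keeps the successor of an even
    number in range. Transported to \<open>N\<close> this is the pairing \<open>p\<close>, and
    \<open>t\<close> gives partners opposite signs.\<close>
  define f :: "nat \<Rightarrow> nat" where "f n = (if even n then Suc n else n - 1)" for n
  have f: "f n < card N" "f (f n) = n" if "n < card N" for n
    using that \<open>even (card N)\<close> by (auto simp: f_def elim!: oddE evenE)
  define p where "p i = h (f (g i))" for i
  define t :: "'n \<Rightarrow> real" where "t i = (- 1) ^ g i" for i
  have p: "p i \<in> N" "p (p i) = i" if "i \<in> N" for i
    using that f[of "g i"] g[of i] gh by (auto simp: p_def)
  have t: "t (p i) = - t i" if "i \<in> N" for i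
    using that f[of "g i"] g[of i] gh by (auto simp: p_def t_def f_def elim!: oddE)
  have tt: "t i * t i = 1" for i
    by (simp add: t_def flip: power_mult_distrib)
  define J :: "'k^'n^'n" where "J = (\<chi> i j. if i \<in> N \<and> j = p i then of_real (t i) else 0)"
  have J_star: "conj_transpose J = - J"
    using p t by (auto simp: conj_transpose_def J_def vec_eq_iff)
  have "J ** conj_transpose J = diagonal (indicat_real N)"
  proof -
    have "(J ** conj_transpose J) $ i $ j = (if i = j \<and> i \<in> N then 1 else 0)" for i j
    proof -
      have "J $ i $ k * conjugate (J $ j $ k) =
          (if k = p i then if i \<in> N \<and> j \<in> N \<and> p j = p i then of_real (t i * t j) else 0 else 0)" for k
        by (auto simp: J_def)
      then have "(J ** conj_transpose J) $ i $ j =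
          (\<Sum>k\<in>UNIV. if k = p i then if i \<in> N \<and> j \<in> N \<and> p j = p i then of_real (t i * t j) else 0 else 0)"
        by (simp only: matrix_matrix_mult_def conj_transpose_def vec_lambda_beta)
      also have "\<dots> = (if i \<in> N \<and> j \<in> N \<and> p j = p i then of_real (t i * t j) else 0)"
        by simp
      finally show ?thesis using p(2) tt by (metis of_real_1)
    qed
    then show ?thesis by (simp add: vec_eq_iff diagonal_def indicator_def)
  qed
  moreover have "entrywise \<phi> J = J"
    by (simp add: vec_eq_iff J_def if_distrib[of \<phi>] \<phi> cong: if_cong)
  ultimately have "block_root \<phi> (- 1) N J"
    using p by (auto simp: block_root_def J_star) (auto simp: J_def)
  then show ?thesis by blast
qed

text \<open>The determinant of the right-hand side is (-1) to the power \<open>card (- N)\<close>,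
  and a nonnegative value forces the exponent to be even.\<close>

lemma even_card_if_det_nonneg:
  fixes A :: "'k::{conj_algebra,field}^'n^'n"
  assumes nonneg: "\<exists>r\<ge>0. det A * det (entrywise \<phi> A) = of_real r"
    and A: "A ** entrywise \<phi> A = diagonal (\<lambda>i. if i \<in> N then 1 else - 1)"
  shows "even (card (- N))"
proof -
  obtain r where r: "0 \<le> r" "det A * det (entrywise \<phi> A) = of_real r"
    using nonneg by blast
  have "of_real r = det (diagonal (\<lambda>i. if i \<in> N then 1 else - 1) :: 'k^'n^'n)"
    using r by (simp add: det_mul flip: A)
  also have "\<dots> = (\<Prod>i\<in>UNIV. of_real (if i \<in> N then 1 else - 1))"
    by (subst det_diagonal) (simp_all add: diagonal_def)
  also have "\<dots> = of_real ((- 1) ^ card (- N))"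
    by (simp add: prod.If_cases Compl_eq if_distrib[of of_real] cong: if_cong)
  finally have "r = (- 1) ^ card (- N)"
    by (simp only: of_real_eq_iff)
  with r(1) show ?thesis
    by (cases "even (card (- N))") auto
qed

lemma block_root_if_det_nonneg:
  fixes S G :: "'k::{conj_algebra,field}^'n^'n"
  assumes frame: "twisted_frame \<sigma> S \<phi> \<epsilon>"
    and nonneg: "\<And>A :: 'k^'n^'n. \<exists>r\<ge>0. det A * det (entrywise \<phi> A) = of_real r"
    and G: "G ** entrywise \<phi> G = diagonal (\<lambda>i. if i \<in> N then 1 else \<epsilon>)"
  shows "\<exists>J. block_root \<phi> \<epsilon> N (J :: 'k^'n^'n)"
proof -
  have \<phi>: "conj_automorphism \<phi>" and "\<epsilon> = 1 \<or> \<epsilon> = - 1" and S: "S ** entrywise \<phi> S = \<epsilon> *\<^sub>R mat 1"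
    using frame by (auto simp: twisted_frame_def)
  then consider "\<epsilon> = 1" | "\<epsilon> = - 1" by blast
  then show ?thesis
  proof cases
    case 1
    with block_root_1[OF \<phi>] show ?thesis by blast
  next
    case 2
    \<comment> \<open>With the empty set in place of \<open>N\<close>, the parity argument concerns
      the full dimension; with \<open>G\<close> it concerns the complement of \<open>N\<close>. The
      difference is the size of the kernel.\<close>
    have "S ** entrywise \<phi> S = diagonal (\<lambda>i. if i \<in> {} then 1 else - 1)"
      by (simp add: S 2 vec_eq_iff diagonal_nth mat_def)
    from even_card_if_det_nonneg[OF nonneg this] have "even CARD('n)" by simp
    moreover have "even (card (- N))"
      by (rule even_card_if_det_nonneg[OF nonneg G[unfolded 2]])
    moreover have "card N + card (- N) = CARD('n)"
      using card_Un_disjoint[of N "- N"] by simp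
    ultimately have "even (card N)"
      by (metis even_add)
    with block_root_even[OF \<phi>] 2 show ?thesis by simp
  qed
qed

lemma symmetric_svd_exists:
  fixes \<sigma> :: "'k::conj_division_algebra^'n::{finite,linorder}^'n::_ \<Rightarrow> 'k^'n::_^'n::_"
  assumes \<sigma>: "star_involution \<sigma>" and frame: "twisted_frame \<sigma> S \<phi> \<epsilon>"
    and Y: "\<sigma> Y = conj_transpose Y" and D: "singular_value_matrix Y D"
    and root: "\<And>N (G :: 'k^'n::_^'n::_). G ** entrywise \<phi> G = diagonal (\<lambda>i. if i \<in> N then 1 else \<epsilon>) \<Longrightarrow>
      \<exists>J :: 'k^'n::_^'n::_. block_root \<phi> \<epsilon> N J"
  shows "\<exists>U V. is_svd Y U D V \<and>
    (let \<Theta> = conj_transpose U ** \<sigma> V in \<sigma> \<Theta> = conj_transpose \<Theta>)"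
proof -
  interpret star_involution \<sigma> by (rule \<sigma>)
  obtain s U where s: "\<And>i. 0 \<le> s i" and Ds: "D = diagonal s" and U: "U \<in> unitary_group"
    and YY: "Y ** conj_transpose Y = U ** (D ** D) ** conj_transpose U"
    using singular_value_matrix_diagonalization[OF D] by blast
  show ?thesis
  proof (rule symmetric_svd[OF frame Y s U YY[unfolded Ds]])
    show "\<exists>J. block_root \<phi> \<epsilon> N J"
      if "G ** entrywise \<phi> G = diagonal (\<lambda>i. if i \<in> N then 1 else \<epsilon>)" for N and G :: "'k^'n::_^'n::_"
      using that by (rule root)
  next
    fix V
    assume "V \<in> unitary_group" "Y = U ** diagonal s ** conj_transpose V"
      "\<sigma> (conj_transpose U ** \<sigma> V) = conj_transpose (conj_transpose U ** \<sigma> V)"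
    with D U show ?thesis
      unfolding is_svd_def Ds Let_def by blast
  qed
qed

section \<open>Real, complex and quaternionic frames\<close>

lemma square_eq_1_if_unit:
  fixes \<kappa> :: "'k::conj_algebra"
  assumes "\<kappa> = of_real r" "\<kappa> * conjugate \<kappa> = 1"
  shows "r = 1 \<or> r = - 1"
proof -
  have "of_real (r * r) = (of_real 1 :: 'k)"
    using assms by simp
  then have "r * r = 1" by (simp only: of_real_eq_iff)
  then show ?thesis by (simp add: square_eq_1_iff)
qed

text \<open>Once the central scalars fixed by \<phi> are real, the scalar from
  \<open>cocycle_scalar\<close> is a real number of modulus one, hence a sign.\<close>

lemma (in star_involution) twisted_frameI:
  assumes S: "S \<in> unitary_group" and \<phi>: "conj_automorphism \<phi>" "\<And>a. \<phi> (\<phi> a) = a"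
    and \<sigma>: "\<And>X. \<sigma> X = S ** entrywise \<phi> X ** conj_transpose S"
    and center: "\<And>\<kappa>. \<phi> \<kappa> = \<kappa> \<Longrightarrow> (\<And>a. a * \<kappa> = \<kappa> * a) \<Longrightarrow> \<exists>r. \<kappa> = of_real r"
  shows "\<exists>\<epsilon>. twisted_frame \<sigma> S \<phi> \<epsilon>"
proof -
  obtain \<kappa> where \<kappa>: "S ** entrywise \<phi> S = mat \<kappa>" "\<phi> \<kappa> = \<kappa>" "\<And>a. a * \<kappa> = \<kappa> * a" "\<kappa> * conjugate \<kappa> = 1"
    using cocycle_scalar[OF S \<phi> \<sigma>] by blast
  then obtain r where r: "\<kappa> = of_real r" using center by blast
  then have "r = 1 \<or> r = - 1" using \<kappa>(4) by (rule square_eq_1_if_unit)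
  then show ?thesis
    using S \<phi>(1) \<sigma> \<kappa>(1) r by (auto simp: twisted_frame_def mat_of_real)
qed

lemma twisted_frame_real:
  fixes \<sigma> :: "real^'n^'n \<Rightarrow> real^'n^'n"
  assumes "star_involution \<sigma>"
  obtains S \<epsilon> where "twisted_frame \<sigma> S (\<lambda>x. x) \<epsilon>"
proof -
  interpret star_involution \<sigma> by (rule assms)
  obtain S \<phi> where S: "S \<in> unitary_group" and \<phi>: "conj_automorphism \<phi>"
    and \<sigma>: "\<And>X. \<sigma> X = S ** entrywise \<phi> X ** conj_transpose S"
    using skolem_noether by blast
  have "\<phi> x = x" for x
    using conj_automorphism_of_real[OF \<phi>, of x] by simp
  then have "\<phi> = (\<lambda>x. x)" by blast
  with twisted_frameI[OF S \<phi> _ \<sigma>] that show thesis by fastforce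
qed

text \<open>Being real-linear and multiplicative, \<phi> is determined by its value at the imaginary
  unit, which is again a square root of -1. The two values give the identity and
  conjugation.\<close>

lemma twisted_frame_complex:
  fixes \<sigma> :: "complex^'n^'n \<Rightarrow> complex^'n^'n"
  assumes "star_involution \<sigma>"
  obtains S where "twisted_frame \<sigma> S (\<lambda>x. x) 1" | S \<epsilon> where "twisted_frame \<sigma> S cnj \<epsilon>"
proof -
  interpret star_involution \<sigma> by (rule assms)
  obtain S \<phi> where S: "S \<in> unitary_group" and \<phi>: "conj_automorphism \<phi>"
    and \<sigma>: "\<And>X. \<sigma> X = S ** entrywise \<phi> X ** conj_transpose S"
    using skolem_noether by blast
  have lin: "linear \<phi>" and mult: "\<phi> a * \<phi> b = \<phi> (a * b)" for a b
    using \<phi> by (simp_all add: conj_automorphism_def)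
  have "\<phi> \<i> * \<phi> \<i> = \<i> * \<i>"
    unfolding mult using conj_automorphism_of_real[OF \<phi>, of "-1"] by simp
  then consider "\<phi> \<i> = \<i>" | "\<phi> \<i> = - \<i>"
    by (metis square_eq_iff)
  moreover have \<phi>_eq: "\<phi> z = of_real (Re z) + Im z *\<^sub>R \<phi> \<i>" for z
  proof -
    have "\<phi> (of_real (Re z) + Im z *\<^sub>R \<i>) = of_real (Re z) + Im z *\<^sub>R \<phi> \<i>"
      by (simp only: linear_add[OF lin] linear_scale[OF lin] conj_automorphism_of_real[OF \<phi>])
    moreover have "of_real (Re z) + Im z *\<^sub>R \<i> = z"
      by (simp add: complex_eq_iff)
    ultimately show ?thesis by simp
  qed
  ultimately show thesis
  proof cases
    case 1
    then have "\<phi> z = z" for z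
      using \<phi>_eq[of z] by (simp add: complex_eq_iff)
    then have \<phi>_id: "\<phi> = (\<lambda>x. x)" by blast
    obtain \<kappa> where \<kappa>: "S ** S = mat \<kappa>" "\<kappa> * conjugate \<kappa> = 1"
      using cocycle_scalar[OF S \<phi> _ \<sigma>] by (auto simp: \<phi>_id)
    \<comment> \<open>For trivial \<phi>, replacing \<open>S\<close> by \<open>S ** mat c\<close>
      multiplies \<kappa> by the square of \<open>c\<close>, so an inverse square root makes the
      scalar 1. As \<kappa> has modulus one, so has \<open>c\<close>, and unitarity
      survives.\<close>
    define c where "c = inverse (csqrt \<kappa>)"
    have "cmod (\<kappa> * cnj \<kappa>) = 1"
      using \<kappa>(2) by (simp add: conjugate_complex_def)
    then have "cmod \<kappa> = 1 \<or> cmod \<kappa> = - 1"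
      by (simp only: norm_mult complex_mod_cnj square_eq_1_iff)
    then have "cmod \<kappa> = 1"
      using norm_ge_zero[of \<kappa>] by linarith
    then have "cmod c = 1" by (simp add: c_def norm_inverse)
    then have c1: "c * cnj c = 1" by (simp add: complex_norm_square[symmetric])
    have "\<kappa> \<noteq> 0" using \<kappa>(2) by auto
    then have c2: "\<kappa> * (c * c) = 1"
      by (simp add: c_def field_simps flip: power2_eq_square)
    define S' where "S' = S ** mat c"
    have comm: "mat c ** X = X ** mat c" for X :: "complex^'n^'n"
      unfolding vec_eq_iff mat_mult_nth mult_mat_nth by simp
    have cc: "X ** mat c ** mat (cnj c) = X" for X :: "complex^'n^'n"
      by (simp add: c1 mat_mult_mat flip: matrix_mul_assoc)
    have "twisted_frame \<sigma> S' (\<lambda>x. x) 1"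
      unfolding twisted_frame_def
    proof (intro conjI allI)
      show "S' \<in> unitary_group"
        using S by (simp add: unitary_group_def S'_def conj_transpose_mult conj_transpose_mat_conjugate
            conjugate_complex_def matrix_mul_assoc cc)
      show "\<sigma> X = S' ** entrywise (\<lambda>x. x) X ** conj_transpose S'" for X
      proof -
        have "S' ** X ** conj_transpose S' = S ** (mat c ** X) ** mat (cnj c) ** conj_transpose S"
          by (simp add: S'_def conj_transpose_mult conj_transpose_mat_conjugate
              conjugate_complex_def matrix_mul_assoc)
        also have "\<dots> = \<sigma> X"
          unfolding comm by (simp add: matrix_mul_assoc cc \<sigma> \<phi>_id)
        finally show ?thesis by simp
      qed
      have "S' ** S' = S ** (mat c ** S) ** mat c"
        by (simp add: S'_def matrix_mul_assoc)
      also have "\<dots> = mat (\<kappa> * (c * c))"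
        unfolding comm by (simp add: matrix_mul_assoc \<kappa> mat_mult_mat mult.assoc)
      finally show "S' ** entrywise (\<lambda>x. x) S' = 1 *\<^sub>R mat 1"
        by (simp add: c2)
    qed (simp_all add: conj_automorphism_ident)
    with that show thesis by blast
  next
    case 2
    then have "\<phi> z = cnj z" for z
      using \<phi>_eq[of z] by (simp add: complex_eq_iff)
    then have \<phi>_cnj: "\<phi> = cnj" by blast
    have "\<exists>\<epsilon>. twisted_frame \<sigma> S \<phi> \<epsilon>"
    proof (rule twisted_frameI[OF S \<phi> _ \<sigma>])
      fix \<kappa> assume "\<phi> \<kappa> = \<kappa>"
      then have "\<kappa> = of_real (Re \<kappa>)" by (simp add: \<phi>_cnj complex_eq_iff)
      then show "\<exists>r. \<kappa> = of_real r" by blast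
    qed (simp add: \<phi>_cnj)
    with that show thesis by (auto simp: \<phi>_cnj)
  qed
qed

lemma det_entrywise_cnj: "det (entrywise cnj A) = cnj (det A)"
  by (simp add: det_def)

section \<open>Quaternion units and inner automorphisms\<close>

abbreviation "quat_i \<equiv> Quat 0 1 0 0"
abbreviation "quat_j \<equiv> Quat 0 0 1 0"
abbreviation "quat_k \<equiv> Quat 0 0 0 1"

lemma quat_unit_mult:
  "quat_i * quat_i = - 1" "quat_j * quat_j = - 1" "quat_k * quat_k = - 1"
  "quat_i * quat_j = quat_k" "quat_j * quat_k = quat_i" "quat_k * quat_i = quat_j"
  "quat_j * quat_i = - quat_k" "quat_k * quat_j = - quat_i" "quat_i * quat_k = - quat_j"
  by (simp_all add: quat_eq_iff)

lemma quat_expand: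
  "x = of_real (qRe x) + qI x *\<^sub>R quat_i + qJ x *\<^sub>R quat_j + qK x *\<^sub>R quat_k"
  by (simp add: quat_eq_iff)

text \<open>
  The map \<open>f\<close> averages \<open>a \<mapsto> \<phi>(u) a u\<^sup>-\<^sup>1\<close> over \<open>u \<in> {1, i, j, k}\<close>; its values intertwine the identity
  with \<open>\<phi>\<close>.
\<close>

lemma quat_automorphism_inner:
  assumes \<phi>: "conj_automorphism (\<phi> :: quat \<Rightarrow> quat)"
  obtains q where "q * conjugate q = 1" "conjugate q * q = 1" "\<And>a. \<phi> a = q * a * conjugate q"
proof -
  define I where "I = \<phi> quat_i"
  define J where "J = \<phi> quat_j"
  define K where "K = \<phi> quat_k"
  have lin: "linear \<phi>" and mult: "\<phi> a * \<phi> b = \<phi> (a * b)" for a b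
    using \<phi> by (simp_all add: conj_automorphism_def)
  have neg: "\<phi> (- x) = - \<phi> x" for x by (rule linear_neg[OF lin])
  have IJK: "I * I = - 1" "J * J = - 1" "K * K = - 1" "I * J = K" "J * K = I" "K * I = J"
    "J * I = - K" "K * J = - I" "I * K = - J"
    by (simp_all add: I_def J_def K_def mult quat_unit_mult neg conj_automorphism_1[OF \<phi>])
  have IJK': "I * (I * x) = - x" "J * (J * x) = - x" "K * (K * x) = - x" "I * (J * x) = K * x"
    "J * (K * x) = I * x" "K * (I * x) = J * x" "J * (I * x) = - (K * x)" "K * (J * x) = - (I * x)"
    "I * (K * x) = - (J * x)" for x
    by (simp_all add: IJK flip: mult.assoc)
  define f where "f a = a - I * (a * quat_i) - J * (a * quat_j) - K * (a * quat_k)" for a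
  note simps = f_def mult.assoc IJK' quat_unit_mult distrib_left distrib_right
    right_diff_distrib left_diff_distrib
  have f: "I * f a = f a * quat_i" "J * f a = f a * quat_j" "K * f a = f a * quat_k" for a
    by (simp_all add: simps)
  have intertwine: "\<phi> b * f a = f a * b" for a b
  proof -
    have "\<phi> b = of_real (qRe b) + qI b *\<^sub>R I + qJ b *\<^sub>R J + qK b *\<^sub>R K"
      by (subst quat_expand) (simp only: linear_add[OF lin] linear_scale[OF lin]
          conj_automorphism_of_real[OF \<phi>] I_def J_def K_def)
    then have "\<phi> b * f a = f a * (of_real (qRe b) + qI b *\<^sub>R quat_i + qJ b *\<^sub>R quat_j + qK b *\<^sub>R quat_k)"
      by (simp add: distrib_left distrib_right f of_real_scaleR_mult mult_of_real_scaleR)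
    then show ?thesis by (simp flip: quat_expand)
  qed
  \<comment> \<open>The left side sums f(u) times the inverse of u over the four units. The term a
    of f contributes 1 for each unit; the terms in \<open>I\<close>, \<open>J\<close> and
    \<open>K\<close> cancel, since each of i, j, k commutes with two of the units and anticommutes
    with the other two. Hence \<open>f\<close> is not zero on all four.\<close>
  have f_sum: "f 1 - f quat_i * quat_i - f quat_j * quat_j - f quat_k * quat_k = 4"
    by (simp add: simps)
  have "\<exists>a. f a \<noteq> 0"
  proof (rule ccontr)
    assume "\<not> ?thesis"
    with f_sum show False by simp
  qed
  then obtain a where a: "f a \<noteq> 0" by blast
  define q where "q = inverse (norm (f a)) *\<^sub>R f a"
  have "norm q = 1" using a by (simp add: q_def)
  then have q: "conjugate q * q = 1"
    by (simp add: conjugate_mult_self dot_square_norm)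
  have q': "q * conjugate q = 1"
    using q by (simp add: quat_eq_iff algebra_simps)
  have "\<phi> b * q = q * b" for b
    by (simp add: q_def intertwine)
  then have "\<phi> b * (q * conjugate q) = q * b * conjugate q" for b
    by (simp flip: mult.assoc)
  with that q q' show thesis by simp
qed

text \<open>The scalar automorphism is conjugation by a unit quaternion \<open>q\<close>, so
  replacing \<open>S\<close> by \<open>S ** mat q\<close> absorbs it and leaves the
  identity.\<close>

lemma twisted_frame_quat:
  fixes \<sigma> :: "quat^'n^'n \<Rightarrow> quat^'n^'n"
  assumes "star_involution \<sigma>"
  obtains S \<epsilon> where "twisted_frame \<sigma> S (\<lambda>x. x) \<epsilon>"
proof -
  interpret star_involution \<sigma> by (rule assms)
  obtain S \<phi> where S: "S \<in> unitary_group" and \<phi>: "conj_automorphism \<phi>"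
    and \<sigma>: "\<And>X. \<sigma> X = S ** entrywise \<phi> X ** conj_transpose S"
    using skolem_noether by blast
  obtain q where q: "q * conjugate q = 1" "\<And>a. \<phi> a = q * a * conjugate q"
    using quat_automorphism_inner[OF \<phi>] by blast
  define S' where "S' = S ** mat q"
  have "mat q \<in> unitary_group"
    by (simp add: unitary_group_def conj_transpose_mat_conjugate mat_mult_mat q)
  then have S': "S' \<in> unitary_group"
    unfolding S'_def using S by (intro unitary_group_mult)
  have "entrywise \<phi> X = mat q ** X ** mat (conjugate q)" for X :: "quat^'n^'n"
    unfolding vec_eq_iff mult_mat_nth mat_mult_nth by (simp add: q)
  then have "\<sigma> X = S' ** entrywise (\<lambda>x. x) X ** conj_transpose S'" for X
    by (simp add: \<sigma> S'_def conj_transpose_mult conj_transpose_mat_conjugate matrix_mul_assoc)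
  then have "\<exists>\<epsilon>. twisted_frame \<sigma> S' (\<lambda>x. x) \<epsilon>"
  proof (rule twisted_frameI[OF S' conj_automorphism_ident refl])
    fix \<kappa> :: quat assume "\<And>a. a * \<kappa> = \<kappa> * a"
    from this[of quat_i] this[of quat_j] have "\<kappa> = of_real (qRe \<kappa>)"
      by (simp add: quat_eq_iff)
    then show "\<exists>r. \<kappa> = of_real r" by blast
  qed
  with that show thesis by blast
qed

text \<open>With the trivial scalar automorphism, \<epsilon> = -1 asks for a skew-Hermitian matrix
  that is unitary on \<open>N\<close>. A purely imaginary unit on the diagonal is one, whatever the
  parity of \<open>N\<close>.\<close>

lemma block_root_quat:
  assumes "\<epsilon> = 1 \<or> \<epsilon> = - 1"
  shows "\<exists>J :: quat^'n^'n. block_root (\<lambda>x. x) \<epsilon> N J"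
  using assms
proof
  assume "\<epsilon> = 1"
  with block_root_1[OF conj_automorphism_ident] show ?thesis by blast
next
  define J :: "quat^'n^'n" where "J = (\<chi> i j. if i = j \<and> i \<in> N then quat_i else 0)"
  have J_star: "conj_transpose J = - J"
    by (auto simp: J_def conj_transpose_def vec_eq_iff quat_eq_iff)
  have "J ** J = - diagonal (indicat_real N)"
  proof -
    have "J $ i $ k * J $ k $ j = (if k = i then if i = j \<and> i \<in> N then - 1 else 0 else 0)" for i j k
      by (auto simp: J_def quat_unit_mult)
    then show ?thesis
      by (simp add: matrix_matrix_mult_def vec_eq_iff diagonal_nth indicator_def)
  qed
  moreover have "J ** (- J) = - (J ** J)"
    using matrix_mult_scaleR[of J "- 1" J] by simp
  moreover assume "\<epsilon> = - 1"
  ultimately have "block_root (\<lambda>x. x) \<epsilon> N J"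
    by (simp add: block_root_def J_star) (auto simp: J_def)
  then show ?thesis by blast
qed

theorem corollary5p6:
  shows "(\<forall>(\<sigma> :: real^'n::{finite,linorder}^'n::_ \<Rightarrow> real^'n::_^'n::_) Y D.
        involutive_automorphism \<sigma> \<and>
        (\<forall>X. \<sigma> (conj_transpose X) = conj_transpose (\<sigma> X)) \<and>
        \<sigma> Y = conj_transpose Y \<and>
        singular_value_matrix Y D \<and> pos_semidef (\<sigma> D) \<longrightarrow>
        (\<exists>U V. is_svd Y U D V \<and>
           (let \<Theta> = conj_transpose U ** \<sigma> V in \<sigma> \<Theta> = conj_transpose \<Theta>))) \<and>
     (\<forall>(\<sigma> :: complex^'n::{finite,linorder}^'n::_ \<Rightarrow> complex^'n::_^'n::_) Y D.
        involutive_automorphism \<sigma> \<and>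
        (\<forall>X. \<sigma> (conj_transpose X) = conj_transpose (\<sigma> X)) \<and>
        \<sigma> Y = conj_transpose Y \<and>
        singular_value_matrix Y D \<and> pos_semidef (\<sigma> D) \<longrightarrow>
        (\<exists>U V. is_svd Y U D V \<and>
           (let \<Theta> = conj_transpose U ** \<sigma> V in \<sigma> \<Theta> = conj_transpose \<Theta>))) \<and>
     (\<forall>(\<sigma> :: quat^'n::{finite,linorder}^'n::_ \<Rightarrow> quat^'n::_^'n::_) Y D.
        involutive_automorphism \<sigma> \<and>
        (\<forall>X. \<sigma> (conj_transpose X) = conj_transpose (\<sigma> X)) \<and>
        \<sigma> Y = conj_transpose Y \<and>
        singular_value_matrix Y D \<and> pos_semidef (\<sigma> D) \<longrightarrow>
        (\<exists>U V. is_svd Y U D V \<and>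
           (let \<Theta> = conj_transpose U ** \<sigma> V in \<sigma> \<Theta> = conj_transpose \<Theta>)))"
proof (intro conjI allI impI; elim conjE)
  fix \<sigma> :: "real^'n::_^'n::_ \<Rightarrow> real^'n::_^'n::_" and Y D :: "real^'n::_^'n::_"
  assume "involutive_automorphism \<sigma>" "\<forall>X. \<sigma> (conj_transpose X) = conj_transpose (\<sigma> X)"
    and Y: "\<sigma> Y = conj_transpose Y" and D: "singular_value_matrix Y D"
  then have \<sigma>: "star_involution \<sigma>" by (simp add: star_involution_def)
  then obtain S \<epsilon> where frame: "twisted_frame \<sigma> S (\<lambda>x. x) \<epsilon>"
    by (rule twisted_frame_real)
  show "\<exists>U V. is_svd Y U D V \<and>
      (let \<Theta> = conj_transpose U ** \<sigma> V in \<sigma> \<Theta> = conj_transpose \<Theta>)"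
  proof (rule symmetric_svd_exists[OF \<sigma> frame Y D], rule block_root_if_det_nonneg[OF frame])
    show "\<exists>r\<ge>0. det A * det (entrywise (\<lambda>x. x) A) = of_real r" for A :: "real^'n::_^'n::_"
      by (intro exI[of _ "det A * det A"]) simp
  qed
next
  fix \<sigma> :: "complex^'n::_^'n::_ \<Rightarrow> complex^'n::_^'n::_" and Y D :: "complex^'n::_^'n::_"
  assume "involutive_automorphism \<sigma>" "\<forall>X. \<sigma> (conj_transpose X) = conj_transpose (\<sigma> X)"
    and Y: "\<sigma> Y = conj_transpose Y" and D: "singular_value_matrix Y D"
  then have \<sigma>: "star_involution \<sigma>" by (simp add: star_involution_def)
  then consider S where "twisted_frame \<sigma> S (\<lambda>x. x) 1" | S \<epsilon> where "twisted_frame \<sigma> S cnj \<epsilon>"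
    by (rule twisted_frame_complex)
  then show "\<exists>U V. is_svd Y U D V \<and>
      (let \<Theta> = conj_transpose U ** \<sigma> V in \<sigma> \<Theta> = conj_transpose \<Theta>)"
  proof cases
    case (1 S)
    \<comment> \<open>The frame is normalised to \<epsilon> = 1, so the coordinate projection onto
      \<open>N\<close> is a root. A determinant argument would give no sign here, as the square of a
      complex determinant can be any complex number.\<close>
    show ?thesis
      using block_root_1[OF conj_automorphism_ident]
      by (intro symmetric_svd_exists[OF \<sigma> 1 Y D]) blast
  next
    case (2 S \<epsilon>)
    show ?thesis
    proof (rule symmetric_svd_exists[OF \<sigma> 2 Y D], rule block_root_if_det_nonneg[OF 2])
      show "\<exists>r\<ge>0. det A * det (entrywise cnj A) = of_real r" for A :: "complex^'n::_^'n::_"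
        by (intro exI[of _ "(cmod (det A))\<^sup>2"])
           (simp only: det_entrywise_cnj complex_norm_square zero_le_power2 simp_thms)
    qed
  qed
next
  fix \<sigma> :: "quat^'n::_^'n::_ \<Rightarrow> quat^'n::_^'n::_" and Y D :: "quat^'n::_^'n::_"
  assume "involutive_automorphism \<sigma>" "\<forall>X. \<sigma> (conj_transpose X) = conj_transpose (\<sigma> X)"
    and Y: "\<sigma> Y = conj_transpose Y" and D: "singular_value_matrix Y D"
  then have \<sigma>: "star_involution \<sigma>" by (simp add: star_involution_def)
  then obtain S \<epsilon> where frame: "twisted_frame \<sigma> S (\<lambda>x. x) \<epsilon>"
    by (rule twisted_frame_quat)
  show "\<exists>U V. is_svd Y U D V \<and>
      (let \<Theta> = conj_transpose U ** \<sigma> V in \<sigma> \<Theta> = conj_transpose \<Theta>)"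
    using frame by (intro symmetric_svd_exists[OF \<sigma> frame Y D] block_root_quat)
      (simp add: twisted_frame_def)
qed

end
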